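(* Let $C$ be a simple unital associative conformal algebra over $\mathbb{C}$ which is finitely generated as a $\mathbb{C}[\partial]$-module. Then there is an integer $n\ge 1$ such that $C$ is isomorphic, as a conformal algebra, to the current algebra $\mathrm{Cur}(\mathrm{Mat}_n(\mathbb{C}))$ over the ring of $n\times n$ matrices over $\mathbb{C}$.
   Context: Everything is over $\mathbb{C}$. Conformal algebra: a $\mathbb{C}[\partial]$-module $C$ with $\mathbb{C}$-bilinear products $\circ_n$, $n\in\mathbb{Z}_{\ge 0}$, such that for all $a,b\in C$: (C1, locality) $a\circ_n b=0$ for all sufficiently large $n$; (C2) $\partial(a\circ_n b)=(\partial a)\circ_n b+a\circ_n(\partial b)$; (C3) $(\partial a)\circ_n b=-n\,a\circ_{n-1}b$ (so $(\partial a)\circ_0 b=0$). Isomorphisms are $\mathbb{C}[\partial]$-linear bijections preserving all $\circ_n$. Coefficient algebra: on $\tilde C=C[t,t^{-1}]$ put $(at^l)\circ_0(bt^m)=\sum_{j\ge 0}\binom{l}{j}(a\circ_j b)\,t^{l+m-j}$. Then $\operatorname{Coeff}C=(\tilde C,\circ_0)/(\partial+\frac{d}{dt})\tilde C$. $C$ is called associative if $\operatorname{Coeff}C$ is an associative algebra; equivalently, $f\circ_m(g\circ_n h)=\sum_{j\ge 0}\binom{m}{j}(f\circ_j g)\circ_{m+n-j}h$ for all $f,g,h\in C$ and $m,n\ge 0$. Unital: there is $e\in C$ (a conformal identity) such that $e\circ_0 f=f$ for all $f\in C$ and the locality degree of $e$ with itself is $1$, i.e. $e\circ_n e=0$ for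 all $n\ge 1$ while $e\circ_0 e\ne 0$. Simple: $C$ has no ideals other than $0$ and $C$, where an ideal is a conformal subalgebra ($\mathbb{C}[\partial]$-submodule closed under all $\circ_n$) closed under left and right multiplications of every order by elements of $C$. Current algebra: for an associative algebra $A$, $\mathrm{Cur}(A)$ is the conformal algebra spanned over $\mathbb{C}[\partial]$ by the formal distributions $f_a=\sum_{n\in\mathbb{Z}}at^nz^{-n-1}$, $a\in A$, over $A[t,t^{-1}]$ ($t$ commuting with $A$), $\partial=d/dz$; equivalently $\mathrm{Cur}(A)=\mathbb{C}[\partial]\otimes A$ with $f_a\circ_0 f_b=f_{ab}$ and $f_a\circ_n f_b=0$ for $n\ge 1$, extended by (C2) and (C3). *)

theory Defs
  imports
    "HOL-Analysis.Analysis"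
    "HOL-Library.Function_Algebras"
    "HOL-Library.Poly_Mapping"
    "HOL-Computational_Algebra.Polynomial"
begin

text \<open>
  \<open>\<complex>[\<partial>]\<close> is the ring \<^typ>\<open>complex poly\<close>, with \<open>\<partial>\<close> the polynomial \<open>[:0, 1:]\<close>.  The underlying
  \<open>\<complex>[\<partial>]\<close>-module of a conformal algebra is a submodule \<open>C\<close> of an ambient module given by
  \<open>smul\<close>; the ambient module may be \<open>C\<close> itself (\<open>C = UNIV\<close>), so this is no restriction.
  The product \<open>a \<circ>\<^sub>n b\<close> is \<open>nprod n a b\<close>; only its values on \<open>C\<close> matter.
\<close>

locale conformal_algebra = module smul
  for smul :: "complex poly \<Rightarrow> 'c::ab_group_add \<Rightarrow> 'c" +
  fixes C :: "'c set"
    and nprod :: "nat \<Rightarrow> 'c \<Rightarrow> 'c \<Rightarrow> 'c"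
  assumes subspace_carrier: "subspace C"
    and nprod_closed: "a \<in> C \<Longrightarrow> b \<in> C \<Longrightarrow> nprod n a b \<in> C"
    and nprod_add_left:
      "a \<in> C \<Longrightarrow> a' \<in> C \<Longrightarrow> b \<in> C \<Longrightarrow> nprod n (a + a') b = nprod n a b + nprod n a' b"
    and nprod_add_right:
      "a \<in> C \<Longrightarrow> b \<in> C \<Longrightarrow> b' \<in> C \<Longrightarrow> nprod n a (b + b') = nprod n a b + nprod n a b'"
    and nprod_scale_left:
      "a \<in> C \<Longrightarrow> b \<in> C \<Longrightarrow> nprod n (smul [:c:] a) b = smul [:c:] (nprod n a b)"
    and nprod_scale_right:
      "a \<in> C \<Longrightarrow> b \<in> C \<Longrightarrow> nprod n a (smul [:c:] b) = smul [:c:] (nprod n a b)"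
    and locality: "a \<in> C \<Longrightarrow> b \<in> C \<Longrightarrow> \<exists>N. \<forall>n\<ge>N. nprod n a b = 0"
    and deriv_nprod: "a \<in> C \<Longrightarrow> b \<in> C \<Longrightarrow>
      smul [:0, 1:] (nprod n a b) = nprod n (smul [:0, 1:] a) b + nprod n a (smul [:0, 1:] b)"
    \<comment> \<open>for \<open>n = 0\<close> the right-hand side is \<open>0\<close>, whatever \<open>n - 1\<close> means\<close>
    and nprod_deriv_left: "a \<in> C \<Longrightarrow> b \<in> C \<Longrightarrow>
      nprod n (smul [:0, 1:] a) b = smul [:- of_nat n:] (nprod (n - 1) a b)"
begin

definition conformal_subalgebra :: "'c set \<Rightarrow> bool" where
  "conformal_subalgebra S \<longleftrightarrow>
     subspace S \<and> S \<subseteq> C \<and> (\<forall>n. \<forall>a\<in>S. \<forall>b\<in>S. nprod n a b \<in> S)"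

definition conformal_ideal :: "'c set \<Rightarrow> bool" where
  "conformal_ideal I \<longleftrightarrow>
     conformal_subalgebra I \<and> (\<forall>n. \<forall>a\<in>C. \<forall>x\<in>I. nprod n a x \<in> I \<and> nprod n x a \<in> I)"

definition simple_conformal :: bool where
  "simple_conformal \<longleftrightarrow> (\<forall>I. conformal_ideal I \<longrightarrow> I = {0} \<or> I = C)"

definition conformal_identity :: "'c \<Rightarrow> bool" where
  "conformal_identity e \<longleftrightarrow>
     e \<in> C \<and> (\<forall>f\<in>C. nprod 0 e f = f) \<and> (\<forall>n\<ge>1. nprod n e e = 0) \<and> nprod 0 e e \<noteq> 0"

definition unital_conformal :: bool where
  "unital_conformal \<longleftrightarrow> (\<exists>e. conformal_identity e)"

definition finitely_generated :: bool where
  "finitely_generated \<longleftrightarrow> (\<exists>S. finite S \<and> S \<subseteq> C \<and> span S = C)"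

text \<open>
  The coefficient algebra.  An element \<open>\<Sum>\<^sub>l x\<^sub>l t\<^sup>l\<close> of \<open>C[t, t\<^sup>-\<^sup>1]\<close> is the finitely supported function
  \<open>l \<mapsto> x\<^sub>l\<close> on the integers.
\<close>

definition laurent :: "(int \<Rightarrow>\<^sub>0 'c) set" where
  "laurent = {x. \<forall>l. Poly_Mapping.lookup x l \<in> C}"

text \<open>\<open>(a t\<^sup>l) \<circ>\<^sub>0 (b t\<^sup>m)\<close>; by locality the sum has only finitely many nonzero terms.\<close>

definition laurent_monom_prod :: "'c \<Rightarrow> int \<Rightarrow> 'c \<Rightarrow> int \<Rightarrow> (int \<Rightarrow>\<^sub>0 'c)" where
  "laurent_monom_prod a l b m =
     (\<Sum>j | nprod j a b \<noteq> 0.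
        Poly_Mapping.single (l + m - int j) (smul [:of_int l gchoose j:] (nprod j a b)))"

definition laurent_prod :: "(int \<Rightarrow>\<^sub>0 'c) \<Rightarrow> (int \<Rightarrow>\<^sub>0 'c) \<Rightarrow> (int \<Rightarrow>\<^sub>0 'c)" where
  "laurent_prod x y =
     (\<Sum>l\<in>Poly_Mapping.keys x. \<Sum>m\<in>Poly_Mapping.keys y.
        laurent_monom_prod (Poly_Mapping.lookup x l) l (Poly_Mapping.lookup y m) m)"

text \<open>The operator \<open>\<partial> + d/dt\<close>.\<close>

definition laurent_total_deriv :: "(int \<Rightarrow>\<^sub>0 'c) \<Rightarrow> (int \<Rightarrow>\<^sub>0 'c)" where
  "laurent_total_deriv x =
     (\<Sum>l\<in>Poly_Mapping.keys x.
        Poly_Mapping.single l (smul [:0, 1:] (Poly_Mapping.lookup x l)) +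
        Poly_Mapping.single (l - 1) (smul [:of_int l:] (Poly_Mapping.lookup x l)))"

text \<open>
  Associativity of \<open>Coeff C\<close>, the quotient of \<open>C[t, t\<^sup>-\<^sup>1]\<close> by the image of \<open>\<partial> + d/dt\<close>: two Laurent
  polynomials represent the same element iff their difference lies in that image.
\<close>

definition associative_conformal :: bool where
  "associative_conformal \<longleftrightarrow>
     (\<forall>x\<in>laurent. \<forall>y\<in>laurent. \<forall>z\<in>laurent.
        laurent_prod (laurent_prod x y) z - laurent_prod x (laurent_prod y z)
          \<in> laurent_total_deriv ` laurent)"

end

definition conformal_isomorphism ::
  "(complex poly \<Rightarrow> 'c::ab_group_add \<Rightarrow> 'c) \<Rightarrow> 'c set \<Rightarrow> (nat \<Rightarrow> 'c \<Rightarrow> 'c \<Rightarrow> 'c) \<Rightarrow>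
   (complex poly \<Rightarrow> 'd::ab_group_add \<Rightarrow> 'd) \<Rightarrow> 'd set \<Rightarrow> (nat \<Rightarrow> 'd \<Rightarrow> 'd \<Rightarrow> 'd) \<Rightarrow>
   ('c \<Rightarrow> 'd) \<Rightarrow> bool" where
  "conformal_isomorphism smul C nprod smul' C' nprod' \<phi> \<longleftrightarrow>
     bij_betw \<phi> C C' \<and>
     (\<forall>a\<in>C. \<forall>b\<in>C. \<phi> (a + b) = \<phi> a + \<phi> b) \<and>
     (\<forall>P. \<forall>a\<in>C. \<phi> (smul P a) = smul' P (\<phi> a)) \<and>
     (\<forall>n. \<forall>a\<in>C. \<forall>b\<in>C. \<phi> (nprod n a b) = nprod' n (\<phi> a) (\<phi> b))"

definition conformally_isomorphic ::
  "(complex poly \<Rightarrow> 'c::ab_group_add \<Rightarrow> 'c) \<Rightarrow> 'c set \<Rightarrow> (nat \<Rightarrow> 'c \<Rightarrow> 'c \<Rightarrow> 'c) \<Rightarrow>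
   (complex poly \<Rightarrow> 'd::ab_group_add \<Rightarrow> 'd) \<Rightarrow> 'd set \<Rightarrow> (nat \<Rightarrow> 'd \<Rightarrow> 'd \<Rightarrow> 'd) \<Rightarrow> bool" where
  "conformally_isomorphic smul C nprod smul' C' nprod' \<longleftrightarrow>
     (\<exists>\<phi>. conformal_isomorphism smul C nprod smul' C' nprod' \<phi>)"

text \<open>Associative algebras over \<open>\<complex>\<close>, again as subspaces \<open>A\<close> of an ambient vector space.\<close>

locale associative_algebra = vector_space sc
  for sc :: "complex \<Rightarrow> 'a::ab_group_add \<Rightarrow> 'a" +
  fixes A :: "'a set"
    and mul :: "'a \<Rightarrow> 'a \<Rightarrow> 'a"
  assumes subspace_A: "subspace A"
    and mul_closed: "a \<in> A \<Longrightarrow> b \<in> A \<Longrightarrow> mul a b \<in> A"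
    and mul_add_left: "a \<in> A \<Longrightarrow> a' \<in> A \<Longrightarrow> b \<in> A \<Longrightarrow> mul (a + a') b = mul a b + mul a' b"
    and mul_add_right: "a \<in> A \<Longrightarrow> b \<in> A \<Longrightarrow> b' \<in> A \<Longrightarrow> mul a (b + b') = mul a b + mul a b'"
    and mul_scale_left: "a \<in> A \<Longrightarrow> b \<in> A \<Longrightarrow> mul (sc c a) b = sc c (mul a b)"
    and mul_scale_right: "a \<in> A \<Longrightarrow> b \<in> A \<Longrightarrow> mul a (sc c b) = sc c (mul a b)"
    and mul_assoc: "a \<in> A \<Longrightarrow> b \<in> A \<Longrightarrow> d \<in> A \<Longrightarrow> mul (mul a b) d = mul a (mul b d)"

text \<open>
  The current algebra \<open>Cur(A) = \<complex>[\<partial>] \<otimes> A\<close>: the element \<open>\<Sum>\<^sub>k \<partial>\<^sup>k f\<^bsub>a\<^sub>k\<^esub>\<close> is the polynomial with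
  coefficients \<open>a\<^sub>k \<in> A\<close>, so \<open>f\<^sub>a\<close> is the constant polynomial \<open>[:a:]\<close>.
\<close>

definition cur_carrier :: "'a::ab_group_add set \<Rightarrow> 'a poly set" where
  "cur_carrier A = {p. \<forall>k. coeff p k \<in> A}"

definition cur_scale ::
  "(complex \<Rightarrow> 'a::ab_group_add \<Rightarrow> 'a) \<Rightarrow> complex poly \<Rightarrow> 'a poly \<Rightarrow> 'a poly" where
  "cur_scale sc P p =
     (\<Sum>i\<le>degree P. \<Sum>j\<le>degree p. monom (sc (coeff P i) (coeff p j)) (i + j))"

text \<open>
  \<open>(\<partial>\<^sup>i f\<^sub>a) \<circ>\<^sub>n (\<partial>\<^sup>j f\<^sub>b) = (-1)\<^sup>i n! binom(j, n - i) \<partial>\<^sup>i\<^sup>+\<^sup>j\<^sup>-\<^sup>n f\<^sub>a\<^sub>b\<close> (zero for \<open>i > n\<close>) is what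
  \<open>f\<^sub>a \<circ>\<^sub>0 f\<^sub>b = f\<^sub>a\<^sub>b\<close> and \<open>f\<^sub>a \<circ>\<^sub>n f\<^sub>b = 0\<close> for \<open>n \<ge> 1\<close> force through the two laws for \<open>\<partial>\<close>:
  the first gives \<open>(\<partial>\<^sup>i a) \<circ>\<^sub>n b = (-1)\<^sup>i n!/(n-i)! a \<circ>\<^bsub>n-i\<^esub> b\<close>, and both together give
  \<open>a \<circ>\<^sub>m (\<partial>b) = \<partial>(a \<circ>\<^sub>m b) + m a \<circ>\<^bsub>m-1\<^esub> b\<close>, hence \<open>f\<^sub>a \<circ>\<^sub>m (\<partial>\<^sup>j f\<^sub>b) = m! binom(j, m) \<partial>\<^sup>j\<^sup>-\<^sup>m f\<^sub>a\<^sub>b\<close>.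
  That this does satisfy all the laws is \<open>conformal_algebra_cur\<close> below.
\<close>

definition cur_monom_prod ::
  "(complex \<Rightarrow> 'a::ab_group_add \<Rightarrow> 'a) \<Rightarrow> ('a \<Rightarrow> 'a \<Rightarrow> 'a) \<Rightarrow>
   nat \<Rightarrow> nat \<Rightarrow> 'a \<Rightarrow> nat \<Rightarrow> 'a \<Rightarrow> 'a poly" where
  "cur_monom_prod sc mul n i a j b =
     (if i \<le> n then monom (sc ((- 1) ^ i * fact n * of_nat (j choose (n - i))) (mul a b)) (i + j - n)
      else 0)"

definition cur_prod ::
  "(complex \<Rightarrow> 'a::ab_group_add \<Rightarrow> 'a) \<Rightarrow> ('a \<Rightarrow> 'a \<Rightarrow> 'a) \<Rightarrow>
   nat \<Rightarrow> 'a poly \<Rightarrow> 'a poly \<Rightarrow> 'a poly" where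
  "cur_prod sc mul n p q =
     (\<Sum>i\<le>degree p. \<Sum>j\<le>degree q. cur_monom_prod sc mul n i (coeff p i) j (coeff q j))"

text \<open>
  \<open>Mat\<^sub>n(\<complex>)\<close>, with the size a term rather than a type: a matrix is its family of entries, indexed
  by \<open>{0..<n}\<close> and extended by \<open>0\<close>.  Addition is the pointwise one.
\<close>

definition Mat :: "nat \<Rightarrow> (nat \<Rightarrow> nat \<Rightarrow> complex) set" where
  "Mat n = {M. \<forall>i j. i \<ge> n \<or> j \<ge> n \<longrightarrow> M i j = 0}"

definition mat_scale :: "complex \<Rightarrow> (nat \<Rightarrow> nat \<Rightarrow> complex) \<Rightarrow> nat \<Rightarrow> nat \<Rightarrow> complex" where
  "mat_scale c M = (\<lambda>i j. c * M i j)"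

definition mat_mult ::
  "nat \<Rightarrow> (nat \<Rightarrow> nat \<Rightarrow> complex) \<Rightarrow> (nat \<Rightarrow> nat \<Rightarrow> complex) \<Rightarrow> nat \<Rightarrow> nat \<Rightarrow> complex" where
  "mat_mult n M N = (\<lambda>i j. \<Sum>k<n. M i k * N k j)"

lemma associative_algebra_Mat: "associative_algebra mat_scale (Mat n) (mat_mult n)"
proof -
  interpret vector_space mat_scale
    by unfold_locales (auto simp: mat_scale_def fun_eq_iff algebra_simps)
  show ?thesis
  proof
    show "subspace (Mat n)"
      by (auto simp: subspace_def Mat_def mat_scale_def)
  next
    fix a b d :: "nat \<Rightarrow> nat \<Rightarrow> complex"
    have "(\<Sum>k<n. (\<Sum>l<n. a i l * b l k) * d k j) = (\<Sum>l<n. a i l * (\<Sum>k<n. b l k * d k j))" for i j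
      by (subst sum_distrib_left, subst sum_distrib_right, subst sum.swap)
        (simp add: sum_distrib_left sum_distrib_right mult.assoc)
    then show "mat_mult n (mat_mult n a b) d = mat_mult n a (mat_mult n b d)"
      by (simp add: mat_mult_def)
  qed (auto simp: Mat_def mat_mult_def mat_scale_def fun_eq_iff algebra_simps
      sum.distrib sum_distrib_left)
qed

context associative_algebra
begin

lemma mul_zero:
  assumes "a \<in> A" shows "mul 0 a = 0" "mul a 0 = 0"
  using mul_scale_left[OF assms assms, of 0] mul_scale_right[OF assms assms, of 0] by simp_all

lemma coeff_cur_scale: "coeff (cur_scale sc P p) k = (\<Sum>i\<le>k. sc (coeff P i) (coeff p (k - i)))"
proof -
  have "coeff (cur_scale sc P p) k =
      (\<Sum>i\<le>degree P. \<Sum>j\<le>degree p. if j = k - i \<and> i \<le> k then sc (coeff P i) (coeff p j) else 0)"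
    by (auto simp: cur_scale_def coeff_sum intro!: sum.cong)
  also have "\<dots> = (\<Sum>i\<le>degree P. if i \<le> k then sc (coeff P i) (coeff p (k - i)) else 0)"
  proof (intro sum.cong refl)
    fix i
    show "(\<Sum>j\<le>degree p. if j = k - i \<and> i \<le> k then sc (coeff P i) (coeff p j) else 0) =
        (if i \<le> k then sc (coeff P i) (coeff p (k - i)) else 0)"
      by (cases "i \<le> k") (auto simp: coeff_eq_0)
  qed
  also have "\<dots> = (\<Sum>i\<in>{..degree P} \<union> {..k}. if i \<le> k then sc (coeff P i) (coeff p (k - i)) else 0)"
    by (rule sum.mono_neutral_left) (auto simp: coeff_eq_0)
  also have "\<dots> = (\<Sum>i\<le>k. sc (coeff P i) (coeff p (k - i)))"
    by (rule sum.mono_neutral_cong_right) auto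
  finally show ?thesis .
qed

lemma coeff_cur_prod:
  assumes "p \<in> cur_carrier A" "q \<in> cur_carrier A"
  shows "coeff (cur_prod sc mul n p q) k =
    (\<Sum>i\<le>n. sc ((- 1) ^ i * fact n * of_nat ((k + n - i) choose k))
       (mul (coeff p i) (coeff q (k + n - i))))"
proof -
  have pq: "coeff p i \<in> A" "coeff q i \<in> A" for i
    using assms by (auto simp: cur_carrier_def)
  define F where "F i = (if i \<le> n then sc ((- 1) ^ i * fact n * of_nat ((k + n - i) choose k))
       (mul (coeff p i) (coeff q (k + n - i))) else 0)" for i
  have "(\<Sum>j\<le>degree q. coeff (cur_monom_prod sc mul n i (coeff p i) j (coeff q j)) k) = F i" for i
  proof (cases "i \<le> n")
    case True
    have "coeff (cur_monom_prod sc mul n i (coeff p i) j (coeff q j)) k =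
        (if j = k + n - i then F i else 0)" for j
    proof (cases "n \<le> i + j")
      case n: True
      have "(k + n - i) choose (n - i) = (k + n - i) choose k"
        using True binomial_symmetric[of k "k + n - i"] by simp
      then show ?thesis
        using True n by (auto simp: cur_monom_prod_def F_def)
    qed (use True in \<open>auto simp: cur_monom_prod_def\<close>)
    then show ?thesis
      using pq by (auto simp: F_def coeff_eq_0 mul_zero)
  qed (auto simp: cur_monom_prod_def F_def)
  then have "coeff (cur_prod sc mul n p q) k = (\<Sum>i\<le>degree p. F i)"
    by (simp add: cur_prod_def coeff_sum)
  also have "\<dots> = (\<Sum>i\<in>{..degree p} \<union> {..n}. F i)"
    using pq by (intro sum.mono_neutral_left) (auto simp: F_def coeff_eq_0 mul_zero)
  also have "\<dots> = (\<Sum>i\<le>n. F i)"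
    by (rule sum.mono_neutral_right) (auto simp: F_def)
  finally show ?thesis
    by (simp add: F_def)
qed

lemma coeff_cur_scale_const: "coeff (cur_scale sc [:c:] p) k = sc c (coeff p k)"
proof -
  have "coeff (cur_scale sc [:c:] p) k = (\<Sum>i\<in>{0}. sc (coeff [:c:] i) (coeff p (k - i)))"
    unfolding coeff_cur_scale by (rule sum.mono_neutral_right) (auto simp: coeff_pCons split: nat.splits)
  then show ?thesis by simp
qed

lemma cur_scale_deriv: "cur_scale sc [:0, 1:] p = pCons 0 p"
proof (rule poly_eqI)
  fix k
  have "coeff (cur_scale sc [:0, 1:] p) k =
      (\<Sum>i\<in>{1} \<inter> {..k}. sc (coeff [:0, 1:] i) (coeff p (k - i)))"
    unfolding coeff_cur_scale
    by (rule sum.mono_neutral_right) (auto simp: coeff_pCons split: nat.splits)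
  also have "\<dots> = coeff (pCons 0 p) k"
    by (cases k) auto
  finally show "coeff (cur_scale sc [:0, 1:] p) k = coeff (pCons 0 p) k" .
qed

lemma module_cur_scale: "module (cur_scale sc)"
proof
  fix P Q :: "complex poly" and p q :: "'a poly"
  show "cur_scale sc P (p + q) = cur_scale sc P p + cur_scale sc P q"
    by (rule poly_eqI) (simp add: coeff_cur_scale scale_right_distrib sum.distrib)
  show "cur_scale sc (P + Q) p = cur_scale sc P p + cur_scale sc Q p"
    by (rule poly_eqI) (simp add: coeff_cur_scale scale_left_distrib sum.distrib)
  show "cur_scale sc 1 p = p"
    by (rule poly_eqI) (simp add: one_pCons coeff_cur_scale_const)
  show "cur_scale sc P (cur_scale sc Q p) = cur_scale sc (P * Q) p"
  proof (rule poly_eqI)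
    fix k
    have "coeff (cur_scale sc P (cur_scale sc Q p)) k =
        (\<Sum>i\<le>k. \<Sum>j\<le>k - i. sc (coeff P i * coeff Q j) (coeff p (k - (i + j))))"
      by (simp add: coeff_cur_scale scale_sum_right)
    also have "\<dots> = (\<Sum>l\<le>k. \<Sum>i\<le>l. sc (coeff P i * coeff Q (l - i)) (coeff p (k - l)))"
    proof -
      have "(\<Sum>i\<le>k. \<Sum>j\<le>k - i. sc (coeff P i * coeff Q j) (coeff p (k - (i + j)))) =
          (\<Sum>(i, j)\<in>{(i, j). i + j \<le> k}. sc (coeff P i * coeff Q j) (coeff p (k - (i + j))))"
        by (subst sum.Sigma) (auto intro!: sum.cong)
      also have "\<dots> = (\<Sum>l\<le>k. \<Sum>i\<le>l. sc (coeff P i * coeff Q (l - i)) (coeff p (k - l)))"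
        by (subst sum.triangle_reindex_eq) (auto intro!: sum.cong)
      finally show ?thesis .
    qed
    also have "\<dots> = coeff (cur_scale sc (P * Q) p) k"
      by (simp add: coeff_cur_scale coeff_mult scale_sum_left)
    finally show "coeff (cur_scale sc P (cur_scale sc Q p)) k = coeff (cur_scale sc (P * Q) p) k" .
  qed
qed

lemma cur_prod_const:
  assumes "a \<in> A" "b \<in> A"
  shows "cur_prod sc mul n [:a:] [:b:] = (if n = 0 then [:mul a b:] else 0)"
  using assms by (auto simp: cur_prod_def cur_monom_prod_def monom_0)

lemma conformal_algebra_cur:
  "conformal_algebra (cur_scale sc) (cur_carrier A) (cur_prod sc mul)"
proof -
  interpret cur: module "cur_scale sc" by (rule module_cur_scale)
  have A0: "0 \<in> A" and Aadd: "\<And>x y. x \<in> A \<Longrightarrow> y \<in> A \<Longrightarrow> x + y \<in> A"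
    and Asc: "\<And>c x. x \<in> A \<Longrightarrow> sc c x \<in> A"
    using subspace_A by (auto simp: subspace_def)
  have co: "coeff p i \<in> A" if "p \<in> cur_carrier A" for p i
    using that by (auto simp: cur_carrier_def)
  have sub: "cur.subspace (cur_carrier A)"
    unfolding cur.subspace_def
    by (auto simp: cur_carrier_def coeff_cur_scale A0 intro!: Aadd Asc subspace_sum[OF subspace_A])
  have cl: "cur_scale sc P p \<in> cur_carrier A" "p + q \<in> cur_carrier A"
    if "p \<in> cur_carrier A" "q \<in> cur_carrier A" for P p q
    using that sub by (auto simp: cur.subspace_def)
  have clD: "pCons 0 p \<in> cur_carrier A" if "p \<in> cur_carrier A" for p
    using cl(1)[OF that that, of "[:0, 1:]"] by (simp add: cur_scale_deriv)
  have left: "cur_prod sc mul n (pCons 0 p) q = cur_scale sc [:- of_nat n:] (cur_prod sc mul (n - 1) p q)"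
    if p: "p \<in> cur_carrier A" and q: "q \<in> cur_carrier A" for n p q
  proof (rule poly_eqI)
    fix k
    show "coeff (cur_prod sc mul n (pCons 0 p) q) k =
        coeff (cur_scale sc [:- of_nat n:] (cur_prod sc mul (n - 1) p q)) k"
    proof (cases n)
      case 0
      then show ?thesis
        by (simp add: coeff_cur_prod clD p q coeff_cur_scale_const mul_zero co)
    next
      case (Suc m)
      show ?thesis
        by (simp add: Suc coeff_cur_prod clD p q coeff_cur_scale_const mul_zero co
            sum.atMost_Suc_shift scale_sum_right del: sum.atMost_Suc)
          (simp add: algebra_simps)
    qed
  qed
  have right: "pCons 0 (cur_prod sc mul n p q) =
      cur_prod sc mul n (pCons 0 p) q + cur_prod sc mul n p (pCons 0 q)"
    if p: "p \<in> cur_carrier A" and q: "q \<in> cur_carrier A" for n p q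
  proof (rule poly_eqI)
    fix k
    define f where "f i c = sc ((- 1) ^ i * fact n * of_nat c) (mul (coeff p i) (coeff q (k + n - i - 1)))" for i c
    have 1: "coeff (cur_prod sc mul n (pCons 0 p) q) k =
        - (\<Sum>i\<le>n. if i < n then f i ((k + n - i - 1) choose k) else 0)"
    proof (cases n)
      case 0
      then show ?thesis by (simp add: left p q coeff_cur_scale_const)
    next
      case (Suc m)
      have "(\<Sum>i\<le>n. if i < n then f i ((k + n - i - 1) choose k) else 0) =
          (\<Sum>i\<le>m. f i ((k + n - i - 1) choose k))"
        by (simp add: Suc)
      also have "\<dots> = - coeff (cur_prod sc mul n (pCons 0 p) q) k"
        by (simp add: Suc left p q coeff_cur_scale_const coeff_cur_prod scale_sum_right f_def
            sum_negf[symmetric] algebra_simps)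
      finally show ?thesis by simp
    qed
    have pC: "coeff (pCons 0 q) m = (if m = 0 then 0 else coeff q (m - 1))" for m
      by (cases m) auto
    have 2: "coeff (cur_prod sc mul n p (pCons 0 q)) k =
        (\<Sum>i\<le>n. if k + n = i then 0 else f i ((k + n - i) choose k))"
      unfolding coeff_cur_prod[OF p clD[OF q]]
      by (intro sum.cong refl) (auto simp: f_def pC co p mul_zero)
    have 3: "coeff (pCons 0 (cur_prod sc mul n p q)) k =
        (\<Sum>i\<le>n. if k = 0 then 0 else f i ((k + n - i - 1) choose (k - 1)))"
    proof (cases k)
      case (Suc l)
      show ?thesis
        by (simp add: Suc coeff_cur_prod p q f_def)
    qed simp
    have "(if k + n = i then 0 else f i ((k + n - i) choose k)) =
        (if i < n then f i ((k + n - i - 1) choose k) else 0) +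
        (if k = 0 then 0 else f i ((k + n - i - 1) choose (k - 1)))" if "i \<le> n" for i
    proof (cases k)
      case 0
      then show ?thesis using that by (auto simp: f_def)
    next
      case (Suc l)
      then have "k + n - i = Suc (l + n - i)" using that by simp
      moreover have "\<not> i < n \<Longrightarrow> (l + n - i) choose Suc l = 0"
        using that by simp
      ultimately show ?thesis
        using that by (auto simp: Suc f_def algebra_simps)
    qed
    then show "coeff (pCons 0 (cur_prod sc mul n p q)) k =
        coeff (cur_prod sc mul n (pCons 0 p) q + cur_prod sc mul n p (pCons 0 q)) k"
      unfolding coeff_add 1 2 3 by (simp add: sum.distrib)
  qed
  show ?thesis
  proof
    show "cur.subspace (cur_carrier A)" by (rule sub)
  next
    fix p p' q q' n c assume p: "p \<in> cur_carrier A" and q: "q \<in> cur_carrier A"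
    show "cur_prod sc mul n p q \<in> cur_carrier A"
      unfolding cur_carrier_def mem_Collect_eq coeff_cur_prod[OF p q]
      by (intro allI subspace_sum[OF subspace_A] Asc mul_closed co p q)
    show "cur_prod sc mul n (cur_scale sc [:c:] p) q = cur_scale sc [:c:] (cur_prod sc mul n p q)"
      using p q by (intro poly_eqI)
        (simp add: coeff_cur_prod cl coeff_cur_scale_const co mul_scale_left scale_sum_right mult_ac)
    show "cur_prod sc mul n p (cur_scale sc [:c:] q) = cur_scale sc [:c:] (cur_prod sc mul n p q)"
      using p q by (intro poly_eqI)
        (simp add: coeff_cur_prod cl coeff_cur_scale_const co mul_scale_right scale_sum_right mult_ac)
    show "cur_scale sc [:0, 1:] (cur_prod sc mul n p q) =
        cur_prod sc mul n (cur_scale sc [:0, 1:] p) q + cur_prod sc mul n p (cur_scale sc [:0, 1:] q)"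
      unfolding cur_scale_deriv by (rule right[OF p q])
    show "cur_prod sc mul n (cur_scale sc [:0, 1:] p) q =
        cur_scale sc [:- of_nat n:] (cur_prod sc mul (n - 1) p q)"
      unfolding cur_scale_deriv by (rule left[OF p q])
    show "\<exists>N. \<forall>n\<ge>N. cur_prod sc mul n p q = 0"
    proof (intro exI allI impI)
      fix n assume n: "n \<ge> degree p + degree q + 1"
      show "cur_prod sc mul n p q = 0"
      proof (rule poly_eqI)
        fix k
        have "mul (coeff p i) (coeff q (k + n - i)) = 0" for i
          using n by (cases "i \<le> degree p") (auto simp: coeff_eq_0 mul_zero co p q)
        then show "coeff (cur_prod sc mul n p q) k = coeff 0 k"
          by (simp add: coeff_cur_prod p q)
      qed
    qed
  next
    fix p p' q n assume "p \<in> cur_carrier A" "p' \<in> cur_carrier A" "q \<in> cur_carrier A"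
    then show "cur_prod sc mul n (p + p') q = cur_prod sc mul n p q + cur_prod sc mul n p' q"
      by (intro poly_eqI)
        (simp add: coeff_cur_prod cl co mul_add_left scale_right_distrib sum.distrib)
  next
    fix p q q' n assume "p \<in> cur_carrier A" "q \<in> cur_carrier A" "q' \<in> cur_carrier A"
    then show "cur_prod sc mul n p (q + q') = cur_prod sc mul n p q + cur_prod sc mul n p q'"
      by (intro poly_eqI)
        (simp add: coeff_cur_prod cl co mul_add_right scale_right_distrib sum.distrib)
  qed
qed

end

end

theory Submission
  imports
    Defs
    "HOL-Computational_Algebra.Fundamental_Theorem_Algebra"
begin

text \<open>
  Let \<open>e\<close> be a conformal identity and \<open>D = e \<circ>\<^sub>1\<close>.  Associativity gives \<open>e \<circ>\<^sub>n = D\<^sup>n\<close>, so \<open>D\<close> is locally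
  nilpotent by locality, and the derivation law gives \<open>[D, \<partial>] = 1\<close>.  Hence \<open>C\<close> is a module over the Weyl
  algebra on which \<open>D\<close> acts like \<open>d/d\<partial>\<close>, and \<open>C = \<complex>[\<partial>] \<otimes> A\<close> with \<open>A = ker D\<close>, the \<open>constants\<close>.  As
  \<open>C\<close> is finitely generated, \<open>A\<close> is finite-dimensional.

  The projection \<open>\<rho>\<close> of \<open>C = A \<oplus> \<partial>C\<close> onto \<open>A\<close> makes \<open>A\<close> an associative algebra with unit \<open>e\<close> under
  \<open>a \<star> b = \<rho>(a \<circ>\<^sub>0 b)\<close>.  It acts on \<open>C\<close> by \<open>a \<circ>\<^sub>0\<close>, commuting with \<open>\<partial>\<close>; the action is faithful because
  the left annihilator of \<open>C\<close> is an ideal that misses \<open>e\<close>.  The commutator with \<open>D\<close> is a nilpotent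
  derivation \<open>\<delta>\<close> of \<open>A\<close>.  A \<open>\<delta>\<close>-stable ideal \<open>I\<close> of \<open>A\<close> generates the ideal \<open>\<complex>[\<partial>] I\<close> of \<open>C\<close>, so simplicity
  of \<open>C\<close> makes \<open>A\<close> differentially simple (\<open>differential_algebra_constants\<close>).

  A finite-dimensional unital algebra over \<open>\<complex>\<close> that is differentially simple for a nilpotent derivation
  is a matrix algebra (\<open>matrix_units_exist\<close>): it maps onto the endomorphisms of a minimal left ideal
  by the density theorem, and the kernel is \<open>\<delta>\<close>-stable (\<open>der_annihilator\<close>), hence zero.  So \<open>\<delta>\<close> is inner, and it is
  the commutator with a nilpotent \<open>d\<close> (\<open>derivation_inner_nilpotent\<close>).

  When \<open>\<delta> = 0\<close>, the constants are closed under \<open>\<circ>\<^sub>0\<close>, their higher products vanish, and \<open>C\<close> is the current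
  algebra of \<open>A\<close> (\<open>current_isomorphism\<close>).  When \<open>\<delta> \<noteq> 0\<close>, the identity \<open>e\<close> is the wrong one.  A gauge
  transformation repairs it: \<open>e' = \<Sum>\<^sub>k \<partial>\<^sup>k d\<^sup>k / k!\<close>, a finite sum since \<open>d\<close> is nilpotent, is another
  conformal identity with \<open>e' \<circ>\<^sub>1 = D - d \<circ>\<^sub>0\<close>, and this operator commutes with every \<open>f \<circ>\<^sub>0\<close>
  (\<open>adapted_identity_exists\<close>).  Everything said about \<open>e\<close> holds for \<open>e'\<close>, now with \<open>\<delta> = 0\<close>.
\<close>

section \<open>Minimal subspaces and eigenvectors\<close>

lemma (in vector_space) minimal_subspace_exists:
  assumes "finite S" and "P V"
    and P: "\<And>W. P W \<Longrightarrow> subspace W \<and> W \<subseteq> span S"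
  obtains W where "P W" "\<And>U. P U \<Longrightarrow> U \<subseteq> W \<Longrightarrow> U = W"
proof -
  obtain W where W: "P W" and least: "\<And>U. P U \<Longrightarrow> dim W \<le> dim U"
    using ex_has_least_nat[of P V dim] \<open>P V\<close> by blast
  have "U = W" if U: "P U" "U \<subseteq> W" for U
  proof -
    obtain B' where B': "B' \<subseteq> U" "independent B'" "U \<subseteq> span B'"
      by (rule maximal_independent_subset)
    obtain B where B: "B' \<subseteq> B" "B \<subseteq> W" "independent B" "W \<subseteq> span B"
      using maximal_independent_subset_extend[of B' W] B' U by blast
    have "B \<subseteq> span S"
      using B(2) P[OF W] by blast
    then have "finite B"
      using independent_span_bound[OF \<open>finite S\<close> B(3)] by simp
    have "card B' = dim U" "card B = dim W"
      using B B' by (auto intro: basis_card_eq_dim)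
    then have "B' = B"
      using card_seteq[OF \<open>finite B\<close> B(1)] least[OF U(1)] by simp
    have "span B' \<subseteq> U"
      using B'(1) P[OF U(1)] by (simp add: span_minimal)
    then show "U = W"
      using U(2) B(4) \<open>B' = B\<close> by blast
  qed
  then show thesis
    using W that by blast
qed

text \<open>
  The ambient space may be infinite-dimensional, so there is no matrix or characteristic polynomial
  of \<open>\<theta>\<close> at hand.  Instead the powers \<open>\<theta>\<^sup>i w\<close> are dependent, which gives \<open>p \<noteq> 0\<close> with \<open>p(\<theta>) w = 0\<close>.
  Splitting off linear factors of \<open>p\<close> one at a time, the last nonzero vector is an eigenvector.
\<close>

lemma eigenvector_exists:
  fixes sc :: "complex \<Rightarrow> 'a::ab_group_add \<Rightarrow> 'a"
  assumes vs: "vector_space sc" and W: "module.subspace sc W"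
    and S: "finite S" "W \<subseteq> module.span sc S"
    and closed: "\<And>x. x \<in> W \<Longrightarrow> \<theta> x \<in> W"
    and add: "\<And>x y. x \<in> W \<Longrightarrow> y \<in> W \<Longrightarrow> \<theta> (x + y) = \<theta> x + \<theta> y"
    and scale: "\<And>c x. x \<in> W \<Longrightarrow> \<theta> (sc c x) = sc c (\<theta> x)"
    and w: "w \<in> W" "w \<noteq> 0"
  obtains \<mu> v where "v \<in> W" "v \<noteq> 0" "\<theta> v = sc \<mu> v"
proof -
  interpret vector_space sc by (rule vs)
  have W0: "0 \<in> W" and Wadd: "\<And>x y. x \<in> W \<Longrightarrow> y \<in> W \<Longrightarrow> x + y \<in> W"
    and Wsc: "\<And>c x. x \<in> W \<Longrightarrow> sc c x \<in> W"
    using W by (auto simp: subspace_def)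
  have th0: "\<theta> 0 = 0"
    using scale[OF W0, of 0] by simp
  have pow: "(\<theta> ^^ i) w \<in> W" for i
    by (induction i) (auto intro: closed w)
  have sum_W: "(\<Sum>i\<in>I. f i) \<in> W" if "\<And>i. i \<in> I \<Longrightarrow> f i \<in> W" for I and f :: "nat \<Rightarrow> 'a"
    using that by (rule subspace_sum[OF W])
  have th_sum: "\<theta> (\<Sum>i\<in>I. f i) = (\<Sum>i\<in>I. \<theta> (f i))"
    if "finite I" "\<And>i. i \<in> I \<Longrightarrow> f i \<in> W" for I and f :: "nat \<Rightarrow> 'a"
    using that by (induction I rule: finite_induct) (auto simp: th0 add sum_W)
  \<comment> \<open>\<open>ev p\<close> is \<open>p(\<theta>) w\<close>\<close>
  define ev where "ev p = (\<Sum>i\<le>degree p. sc (coeff p i) ((\<theta> ^^ i) w))" for p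
  have ev_bound: "ev p = (\<Sum>i\<le>n. sc (coeff p i) ((\<theta> ^^ i) w))" if "degree p \<le> n" for p n
    unfolding ev_def using that
    by (intro sum.mono_neutral_left) (auto simp: coeff_eq_0)
  have evW: "ev p \<in> W" for p
    unfolding ev_def by (intro sum_W Wsc pow)
  have ev_add: "ev (p + q) = ev p + ev q" for p q
    using degree_add_le_max[of p q]
    by (simp add: ev_bound[of _ "max (degree p) (degree q)"] scale_left_distrib sum.distrib)
  have ev_smult: "ev (smult c p) = sc c (ev p)" for c p
    using degree_smult_le[of c p]
    by (simp add: ev_bound[of _ "degree p"] scale_sum_right)
  have ev_pCons: "ev (pCons 0 p) = \<theta> (ev p)" for p
  proof -
    have "ev (pCons 0 p) = (\<Sum>i\<le>Suc (degree p). sc (coeff (pCons 0 p) i) ((\<theta> ^^ i) w))"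
      by (rule ev_bound) (simp add: degree_pCons_le)
    also have "\<dots> = (\<Sum>i\<le>degree p. \<theta> (sc (coeff p i) ((\<theta> ^^ i) w)))"
      by (simp add: sum.atMost_Suc_shift scale pow del: sum.atMost_Suc)
    also have "\<dots> = \<theta> (ev p)"
      unfolding ev_def by (rule th_sum[symmetric]) (auto intro: Wsc pow)
    finally show ?thesis .
  qed
  have ev_monom: "ev (monom c i) = sc c ((\<theta> ^^ i) w)" for c i
  proof -
    have "ev (monom c i) = (\<Sum>j\<le>i. sc (coeff (monom c i) j) ((\<theta> ^^ j) w))"
      by (rule ev_bound) (rule degree_monom_le)
    also have "\<dots> = (\<Sum>j\<le>i. if j = i then sc c ((\<theta> ^^ i) w) else 0)"
      by (intro sum.cong) auto
    finally show ?thesis by simp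
  qed
  have "\<exists>p. p \<noteq> 0 \<and> ev p = 0"
  proof (rule ccontr)
    assume "\<not> ?thesis"
    then have inj: "p = 0" if "ev p = 0" for p using that by blast
    let ?v = "\<lambda>i. (\<theta> ^^ i) w"
    have v_inj: "inj_on ?v {..card S}"
    proof (rule inj_onI)
      fix i j assume "?v i = ?v j"
      then have "ev (monom 1 i + monom (- 1) j) = 0"
        by (simp add: ev_add ev_monom)
      then have "monom 1 i + monom (- 1) j = (0 :: complex poly)" by (rule inj)
      then have "coeff (monom 1 i + monom (- 1) j) i = (0::complex)" by simp
      then show "i = j" by (auto split: if_splits)
    qed
    have "independent (?v ` {..card S})"
    proof (rule independent_if_scalars_zero)
      fix f x assume sum0: "(\<Sum>x\<in>?v ` {..card S}. sc (f x) x) = 0" and x: "x \<in> ?v ` {..card S}"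
      define p where "p = (\<Sum>i\<le>card S. monom (f (?v i)) i)"
      have "ev 0 = 0" by (simp add: ev_def)
      have ev_sum: "ev (\<Sum>i\<in>I. monom (f (?v i)) i) = (\<Sum>i\<in>I. sc (f (?v i)) (?v i))"
        if "finite I" for I
        using that \<open>ev 0 = 0\<close> by (induction I rule: finite_induct) (auto simp: ev_add ev_monom)
      have "ev p = 0"
        using sum0 by (simp add: p_def ev_sum sum.reindex[OF v_inj])
      then have "p = 0" by (rule inj)
      obtain i where i: "i \<le> card S" "x = ?v i" using x by auto
      have "coeff p i = f x"
        using i by (simp add: p_def coeff_sum if_distrib cong: if_cong)
      then show "f x = 0" using \<open>p = 0\<close> by simp
    qed simp
    moreover have "?v ` {..card S} \<subseteq> span S"
      using S(2) pow by blast
    ultimately have "card (?v ` {..card S}) \<le> card S"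
      using independent_span_bound[OF S(1)] by blast
    then show False by (simp add: card_image[OF v_inj])
  qed
  then obtain p where "p \<noteq> 0" "ev p = 0" by blast
  then have "\<exists>\<mu> v. v \<in> W \<and> v \<noteq> 0 \<and> \<theta> v = sc \<mu> v"
  proof (induction "degree p" arbitrary: p rule: less_induct)
    case less
    have "degree p \<noteq> 0"
    proof
      assume "degree p = 0"
      then obtain c where "p = [:c:]" by (rule degree_eq_zeroE)
      then show False using less.prems w(2) by (simp add: ev_def)
    qed
    then have "\<not> constant (poly p)"
      by (simp add: constant_degree)
    then obtain r where "poly p r = 0"
      using fundamental_theorem_of_algebra by blast
    then obtain q where q: "p = [:- r, 1:] * q"
      by (metis dvdE poly_eq_0_iff_dvd)
    have q0: "q \<noteq> 0" using q less.prems by auto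
    have "ev p = ev (pCons 0 q + smult (- r) q)"
      by (simp add: q)
    also have "\<dots> = \<theta> (ev q) + sc (- r) (ev q)"
      by (simp only: ev_add ev_pCons ev_smult)
    finally have eq: "\<theta> (ev q) - sc r (ev q) = 0"
      using less.prems by simp
    show ?case
    proof (cases "ev q = 0")
      case True
      have "degree p = Suc (degree q)"
        unfolding q using q0 by (subst degree_mult_eq) auto
      then show ?thesis using less.hyps[of q] q0 True by simp
    next
      case False
      then show ?thesis using eq evW[of q] by (intro exI[of _ r] exI[of _ "ev q"]) auto
    qed
  qed
  then show thesis using that by blast
qed

section \<open>Differentially simple algebras\<close>

text \<open>
  Finite-dimensional unital algebras with a derivation that is nilpotent and leaves no proper nonzero
  ideal stable.  Nilpotency is assumed elementwise, as this is what locality provides.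
\<close>

locale differential_algebra = associative_algebra sc A mul
  for sc :: "complex \<Rightarrow> 'a::ab_group_add \<Rightarrow> 'a" and A mul +
  fixes one :: 'a and \<delta> :: "'a \<Rightarrow> 'a"
  assumes one_closed: "one \<in> A" and one_nonzero: "one \<noteq> 0"
    and one_left: "a \<in> A \<Longrightarrow> mul one a = a"
    and one_right: "a \<in> A \<Longrightarrow> mul a one = a"
    and finite_dim: "\<exists>S. finite S \<and> A \<subseteq> span S"
    and der_closed: "a \<in> A \<Longrightarrow> \<delta> a \<in> A"
    and der_add: "a \<in> A \<Longrightarrow> b \<in> A \<Longrightarrow> \<delta> (a + b) = \<delta> a + \<delta> b"
    and der_scale: "a \<in> A \<Longrightarrow> \<delta> (sc c a) = sc c (\<delta> a)"
    and der_mul: "a \<in> A \<Longrightarrow> b \<in> A \<Longrightarrow> \<delta> (mul a b) = mul (\<delta> a) b + mul a (\<delta> b)"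
    and der_nilpotent: "a \<in> A \<Longrightarrow> \<exists>N. (\<delta> ^^ N) a = 0"
    and der_simple: "subspace I \<Longrightarrow> I \<subseteq> A \<Longrightarrow>
      (\<And>a x. a \<in> A \<Longrightarrow> x \<in> I \<Longrightarrow> mul a x \<in> I \<and> mul x a \<in> I) \<Longrightarrow>
      (\<And>x. x \<in> I \<Longrightarrow> \<delta> x \<in> I) \<Longrightarrow> I = {0} \<or> I = A"
begin

notation mul (infixl "\<odot>" 70)

lemma A_zero: "0 \<in> A"
  and A_add: "a \<in> A \<Longrightarrow> b \<in> A \<Longrightarrow> a + b \<in> A"
  and A_diff: "a \<in> A \<Longrightarrow> b \<in> A \<Longrightarrow> a - b \<in> A"
  and A_scale: "a \<in> A \<Longrightarrow> sc c a \<in> A"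
  and A_sum: "(\<And>i. i \<in> I \<Longrightarrow> f i \<in> A) \<Longrightarrow> sum f I \<in> A"
  using subspace_A by (auto intro: subspace_0 subspace_add subspace_diff subspace_scale subspace_sum)

lemmas A_intros = A_zero A_add A_diff A_scale A_sum mul_closed one_closed der_closed

lemma mul_sum_left: "(\<And>i. i \<in> I \<Longrightarrow> f i \<in> A) \<Longrightarrow> b \<in> A \<Longrightarrow> sum f I \<odot> b = (\<Sum>i\<in>I. f i \<odot> b)"
  by (induction I rule: infinite_finite_induct) (auto simp: mul_zero mul_add_left A_intros)

lemma mul_sum_right: "(\<And>i. i \<in> I \<Longrightarrow> f i \<in> A) \<Longrightarrow> b \<in> A \<Longrightarrow> b \<odot> sum f I = (\<Sum>i\<in>I. b \<odot> f i)"
  by (induction I rule: infinite_finite_induct) (auto simp: mul_zero mul_add_right A_intros)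

lemma mul_diff_left: "a \<in> A \<Longrightarrow> a' \<in> A \<Longrightarrow> b \<in> A \<Longrightarrow> (a - a') \<odot> b = a \<odot> b - a' \<odot> b"
  using mul_add_left[of "a - a'" a' b] by (simp add: A_intros)

lemma mul_diff_right: "a \<in> A \<Longrightarrow> b \<in> A \<Longrightarrow> b' \<in> A \<Longrightarrow> a \<odot> (b - b') = a \<odot> b - a \<odot> b'"
  using mul_add_right[of a "b - b'" b'] by (simp add: A_intros)

lemma der_zero: "\<delta> 0 = 0"
  using der_scale[OF A_zero, of 0] by simp

lemma der_sum: "(\<And>i. i \<in> I \<Longrightarrow> f i \<in> A) \<Longrightarrow> \<delta> (sum f I) = (\<Sum>i\<in>I. \<delta> (f i))"
  by (induction I rule: infinite_finite_induct) (auto simp: der_zero der_add A_intros)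

lemma derpow_closed: "a \<in> A \<Longrightarrow> (\<delta> ^^ n) a \<in> A"
  by (induction n) (auto intro: A_intros)

lemma derpow_zero: "(\<delta> ^^ n) 0 = 0"
  by (induction n) (auto simp: der_zero)

lemma derpow_add: "a \<in> A \<Longrightarrow> b \<in> A \<Longrightarrow> (\<delta> ^^ n) (a + b) = (\<delta> ^^ n) a + (\<delta> ^^ n) b"
  by (induction n) (auto simp: der_add derpow_closed)

lemma derpow_scale: "a \<in> A \<Longrightarrow> (\<delta> ^^ n) (sc c a) = sc c ((\<delta> ^^ n) a)"
  by (induction n) (auto simp: der_scale derpow_closed)

lemma Leibniz:
  assumes "a \<in> A" "b \<in> A"
  shows "(\<delta> ^^ n) (a \<odot> b) =
    (\<Sum>i\<le>n. sc (of_nat (n choose i)) ((\<delta> ^^ i) a \<odot> (\<delta> ^^ (n - i)) b))"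
proof (induction n)
  case 0
  show ?case by simp
next
  case (Suc n)
  let ?t = "\<lambda>i j. (\<delta> ^^ i) a \<odot> (\<delta> ^^ j) b"
  have t: "?t i j \<in> A" for i j
    using assms by (intro A_intros derpow_closed)
  have dt: "\<delta> (?t i j) = ?t (Suc i) j + ?t i (Suc j)" for i j
    using assms by (simp add: der_mul derpow_closed)
  have "(\<delta> ^^ Suc n) (a \<odot> b) = (\<Sum>i\<le>n. sc (of_nat (n choose i)) (?t (Suc i) (n - i) + ?t i (Suc (n - i))))"
    unfolding funpow.simps comp_def Suc.IH by (simp add: der_sum der_scale t dt A_intros)
  also have "\<dots> = (\<Sum>i\<le>n. sc (of_nat (n choose i)) (?t (Suc i) (n - i))) +
      (\<Sum>i\<le>n. sc (of_nat (n choose i)) (?t i (Suc n - i)))"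
    by (simp add: scale_right_distrib sum.distrib Suc_diff_le)
  also have "(\<Sum>i\<le>n. sc (of_nat (n choose i)) (?t i (Suc n - i))) =
      (\<Sum>i\<le>Suc n. sc (of_nat (n choose i)) (?t i (Suc n - i)))"
    by simp
  also have "\<dots> = ?t 0 (Suc n) + (\<Sum>i\<le>n. sc (of_nat (n choose Suc i)) (?t (Suc i) (n - i)))"
    by (simp add: sum.atMost_Suc_shift del: sum.atMost_Suc)
  finally have "(\<delta> ^^ Suc n) (a \<odot> b) = ?t 0 (Suc n) +
     (\<Sum>i\<le>n. sc (of_nat (n choose i) + of_nat (n choose Suc i)) (?t (Suc i) (n - i)))"
    by (simp add: scale_left_distrib sum.distrib)
  also have "\<dots> = (\<Sum>i\<le>Suc n. sc (of_nat (Suc n choose i)) (?t i (Suc n - i)))"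
    by (simp add: sum.atMost_Suc_shift del: sum.atMost_Suc)
  finally show ?case .
qed

lemma der_uniformly_nilpotent: "\<exists>N. \<forall>a\<in>A. (\<delta> ^^ N) a = 0"
proof -
  obtain S where S: "finite S" "A \<subseteq> span S" using finite_dim by blast
  obtain B where B: "B \<subseteq> A" "independent B" "A \<subseteq> span B"
    by (rule maximal_independent_subset)
  have "finite B" using independent_span_bound[OF S(1) B(2)] B(1) S(2) by blast
  from B(1) have "\<forall>b\<in>B. \<exists>N. (\<delta> ^^ N) b = 0" using der_nilpotent by blast
  then obtain N where N: "\<forall>b\<in>B. (\<delta> ^^ N b) b = 0" by metis
  define M where "M = sum N B"
  have bM: "(\<delta> ^^ M) b = 0" if "b \<in> B" for b
  proof -
    have "N b \<le> M" unfolding M_def using that \<open>finite B\<close> by (intro member_le_sum) auto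
    then have "(\<delta> ^^ M) b = (\<delta> ^^ (M - N b + N b)) b" by simp
    also have "\<dots> = (\<delta> ^^ (M - N b)) ((\<delta> ^^ N b) b)" by (simp only: funpow_add o_apply)
    finally show ?thesis using N that by (simp add: derpow_zero)
  qed
  have "subspace {a \<in> A. (\<delta> ^^ M) a = 0}"
    by (auto simp: subspace_def A_intros derpow_zero derpow_add derpow_scale)
  then have "span B \<subseteq> {a \<in> A. (\<delta> ^^ M) a = 0}"
    using B(1) bM by (intro span_minimal) auto
  then show ?thesis using B(3) by blast
qed

definition left_ideal :: "'a set \<Rightarrow> bool" where
  "left_ideal W \<longleftrightarrow> subspace W \<and> W \<subseteq> A \<and> (\<forall>a\<in>A. \<forall>w\<in>W. a \<odot> w \<in> W)"

definition minimal_left_ideal :: "'a set \<Rightarrow> bool" where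
  "minimal_left_ideal W \<longleftrightarrow> left_ideal W \<and> W \<noteq> {0} \<and>
     (\<forall>U. left_ideal U \<longrightarrow> U \<subseteq> W \<longrightarrow> U = {0} \<or> U = W)"

lemma minimal_left_ideal_exists: "\<exists>W. minimal_left_ideal W"
proof -
  obtain S where S: "finite S" "A \<subseteq> span S" using finite_dim by blast
  show ?thesis
  proof (rule minimal_subspace_exists[OF S(1), where P = "\<lambda>W. left_ideal W \<and> W \<noteq> {0}" and V = A])
    show "left_ideal A \<and> A \<noteq> {0}"
      using subspace_A one_closed one_nonzero by (auto simp: left_ideal_def mul_closed)
    show "subspace W \<and> W \<subseteq> span S" if "left_ideal W \<and> W \<noteq> {0}" for W
      using that S(2) unfolding left_ideal_def by blast
    show ?thesis
      if "left_ideal W \<and> W \<noteq> {0}" and "\<And>U. left_ideal U \<and> U \<noteq> {0} \<Longrightarrow> U \<subseteq> W \<Longrightarrow> U = W" for W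
      using that unfolding minimal_left_ideal_def by metis
  qed
qed

end

section \<open>The action on a minimal left ideal\<close>

locale differential_algebra_ideal = differential_algebra sc A mul one \<delta>
  for sc :: "complex \<Rightarrow> 'a::ab_group_add \<Rightarrow> 'a" and A mul one \<delta> +
  fixes W assumes minimal: "minimal_left_ideal W"
begin

lemma W_A: "w \<in> W \<Longrightarrow> w \<in> A"
  and W_zero: "0 \<in> W"
  and W_add: "v \<in> W \<Longrightarrow> w \<in> W \<Longrightarrow> v + w \<in> W"
  and W_diff: "v \<in> W \<Longrightarrow> w \<in> W \<Longrightarrow> v - w \<in> W"
  and W_scale: "w \<in> W \<Longrightarrow> sc c w \<in> W"
  and W_mul: "a \<in> A \<Longrightarrow> w \<in> W \<Longrightarrow> a \<odot> w \<in> W"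
  using minimal unfolding minimal_left_ideal_def left_ideal_def
  by (auto intro: subspace_0 subspace_add subspace_diff subspace_scale)

lemma W_subspace: "subspace W"
  using minimal unfolding minimal_left_ideal_def left_ideal_def by blast

lemma W_nonzero: "\<exists>w\<in>W. w \<noteq> 0"
  using minimal W_zero unfolding minimal_left_ideal_def by blast

lemma W_irreducible: "subspace U \<Longrightarrow> U \<subseteq> W \<Longrightarrow> (\<And>a u. a \<in> A \<Longrightarrow> u \<in> U \<Longrightarrow> a \<odot> u \<in> U) \<Longrightarrow>
   u \<in> U \<Longrightarrow> u \<noteq> 0 \<Longrightarrow> U = W"
  using minimal W_A unfolding minimal_left_ideal_def left_ideal_def by (metis singletonD subsetD subsetI)

lemma W_transitive:
  assumes "v \<in> W" "v \<noteq> 0" "w \<in> W"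
  obtains a where "a \<in> A" "a \<odot> v = w"
proof -
  let ?U = "(\<lambda>a. a \<odot> v) ` A"
  note vA = W_A[OF assms(1)]
  have "?U = W"
  proof (rule W_irreducible)
    show "subspace ?U"
      unfolding subspace_def using vA
      by (auto simp: mul_zero image_iff A_intros
         mul_add_left[symmetric] mul_scale_left[symmetric] intro: bexI[of _ 0])
    show "?U \<subseteq> W" using assms W_mul by auto
    show "a \<odot> u \<in> ?U" if "a \<in> A" "u \<in> ?U" for a u
      using that vA by (auto simp: mul_assoc[symmetric] mul_closed)
    show "v \<in> ?U" using one_left[OF vA] one_closed by (metis imageI)
  qed fact
  then show thesis using assms(3) that by blast
qed

lemma W_finite: "\<exists>S. finite S \<and> W \<subseteq> span S"
  using finite_dim W_A by blast

text \<open>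
  Jacobson density with Schur's lemma built in.  In the induction step, suppose every \<open>a\<close> that kills
  \<open>insert t T\<close> kills \<open>v\<close>.  With \<open>J\<close> the annihilator of \<open>T\<close>, the induction hypothesis gives \<open>J t = W\<close>, so
  \<open>a t \<mapsto> a v\<close> for \<open>a \<in> J\<close> is a well-defined module endomorphism of \<open>W\<close>.  It has an eigenvalue \<open>\<mu>\<close>, and its
  eigenspace is a submodule, so it is the scalar \<open>\<mu>\<close>.  Then \<open>J\<close> kills \<open>v - \<mu> t\<close>, which contradicts the
  induction hypothesis.
\<close>

lemma density:
  assumes "finite T" "T \<subseteq> W" "v \<in> W" "v \<notin> span T"
  shows "\<exists>a\<in>A. (\<forall>t\<in>T. a \<odot> t = 0) \<and> a \<odot> v \<noteq> 0"
  using assms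
proof (induction T arbitrary: v rule: finite_induct)
  case empty
  then show ?case using one_closed W_A by (auto intro!: bexI[of _ one] simp: one_left)
next
  case (insert t T)
  have tW: "t \<in> W" and TW: "T \<subseteq> W" using insert.prems by auto
  let ?J = "{a \<in> A. \<forall>s\<in>T. a \<odot> s = 0}"
  have sA: "s \<in> T \<Longrightarrow> s \<in> A" for s using TW W_A by blast
  note vA = W_A[OF \<open>v \<in> W\<close>] and tA = W_A[OF tW]
  show ?case
  proof (rule ccontr)
    assume "\<not> ?case"
    then have contra: "a \<odot> v = 0" if "a \<in> ?J" "a \<odot> t = 0" for a using that by blast
    have "t \<notin> span T"
    proof
      assume t: "t \<in> span T"
      then have "v \<notin> span T" using insert.prems by (simp add: span_redundant)
      then obtain a where a: "a \<in> ?J" "a \<odot> v \<noteq> 0"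
        using insert.IH[OF TW] insert.prems by blast
      have "T \<subseteq> {x \<in> A. a \<odot> x = 0}" using a sA by auto
      moreover have "subspace {x \<in> A. a \<odot> x = 0}"
        using a by (auto simp: subspace_def A_intros mul_zero mul_add_right mul_scale_right)
      ultimately have "a \<odot> t = 0" using t span_minimal by blast
      then show False using contra a by blast
    qed
    then obtain j0 where j0: "j0 \<in> ?J" "j0 \<odot> t \<noteq> 0"
      using insert.IH[OF TW tW] by blast
    have Jmul: "b \<odot> a \<in> ?J" if "b \<in> A" "a \<in> ?J" for a b
      using that sA by (auto simp: mul_closed mul_assoc mul_zero)
    have Jt: "\<exists>a\<in>?J. a \<odot> t = w" if w: "w \<in> W" for w
    proof -
      have "j0 \<odot> t \<in> W" using j0 tW W_mul by blast
      then obtain b where "b \<in> A" "b \<odot> (j0 \<odot> t) = w"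
        using W_transitive j0 w by metis
      then show ?thesis using Jmul[of b j0] j0 tA by (intro bexI[of _ "b \<odot> j0"]) (auto simp: mul_assoc)
    qed
    define \<theta> where "\<theta> w = (SOME x. \<exists>a\<in>?J. a \<odot> t = w \<and> x = a \<odot> v)" for w
    have th: "\<theta> (a \<odot> t) = a \<odot> v" if a: "a \<in> ?J" for a
      unfolding \<theta>_def
    proof (rule some_equality)
      fix x assume "\<exists>b\<in>?J. b \<odot> t = a \<odot> t \<and> x = b \<odot> v"
      then obtain b where b: "b \<in> ?J" "b \<odot> t = a \<odot> t" "x = b \<odot> v" by blast
      have "a - b \<in> ?J" using a b sA by (auto simp: A_intros mul_diff_left)
      moreover have "(a - b) \<odot> t = 0" using a b tA by (simp add: mul_diff_left)
      ultimately have "(a - b) \<odot> v = 0" by (rule contra)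
      then show "x = a \<odot> v" using a b vA by (simp add: mul_diff_left)
    qed (use a in blast)
    have thW: "\<theta> w \<in> W" if "w \<in> W" for w
      using Jt[OF that] th insert.prems W_mul by fastforce
    have th_add: "\<theta> (x + y) = \<theta> x + \<theta> y" if "x \<in> W" "y \<in> W" for x y
    proof -
      obtain a b where a: "a \<in> ?J" "a \<odot> t = x" and b: "b \<in> ?J" "b \<odot> t = y"
        using Jt[OF \<open>x \<in> W\<close>] Jt[OF \<open>y \<in> W\<close>] by blast
      have ab: "a + b \<in> ?J" using a b sA by (auto simp: A_intros mul_add_left)
      have "(a + b) \<odot> t = x + y" using a b tA by (auto simp: mul_add_left)
      then have "\<theta> (x + y) = (a + b) \<odot> v" using th[OF ab] by simp
      also have "\<dots> = \<theta> x + \<theta> y" using th[OF a(1)] th[OF b(1)] a b vA by (auto simp: mul_add_left)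
      finally show ?thesis .
    qed
    have th_scale: "\<theta> (sc c x) = sc c (\<theta> x)" if x: "x \<in> W" for c x
    proof -
      obtain a where a: "a \<in> ?J" "a \<odot> t = x" using Jt[OF x] by blast
      have ca: "sc c a \<in> ?J" using a sA by (auto simp: A_intros mul_scale_left)
      have "sc c a \<odot> t = sc c x" using a tA by (auto simp: mul_scale_left)
      then have "\<theta> (sc c x) = sc c a \<odot> v" using th[OF ca] by simp
      also have "\<dots> = sc c (\<theta> x)" using th[OF a(1)] a vA by (auto simp: mul_scale_left)
      finally show ?thesis .
    qed
    have th_mul: "\<theta> (b \<odot> x) = b \<odot> \<theta> x" if x: "x \<in> W" and b: "b \<in> A" for b x
    proof -
      obtain a where a: "a \<in> ?J" "a \<odot> t = x" using Jt[OF x] by blast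
      have "(b \<odot> a) \<odot> t = b \<odot> x" using a b tA by (auto simp: mul_assoc)
      then have "\<theta> (b \<odot> x) = (b \<odot> a) \<odot> v" using th[OF Jmul[OF b a(1)]] by simp
      also have "\<dots> = b \<odot> \<theta> x" using th[OF a(1)] a b vA by (auto simp: mul_assoc)
      finally show ?thesis .
    qed
    obtain S where S: "finite S" "W \<subseteq> span S" using W_finite by blast
    obtain w where "w \<in> W" "w \<noteq> 0" using W_nonzero by blast
    from eigenvector_exists[OF vector_space_axioms W_subspace S thW th_add th_scale this]
    obtain \<mu> w0 where w0: "w0 \<in> W" "w0 \<noteq> 0" "\<theta> w0 = sc \<mu> w0" by metis
    have "{w \<in> W. \<theta> w = sc \<mu> w} = W"
    proof (rule W_irreducible)
      show "subspace {w \<in> W. \<theta> w = sc \<mu> w}"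
        using th_scale[OF W_zero, of 0]
        by (auto simp: subspace_def W_zero W_add W_scale th_add th_scale scale_right_distrib mult.commute)
      show "a \<odot> u \<in> {w \<in> W. \<theta> w = sc \<mu> w}" if "a \<in> A" "u \<in> {w \<in> W. \<theta> w = sc \<mu> w}" for a u
        using that W_A by (auto simp: W_mul th_mul mul_scale_right)
    qed (use w0 in auto)
    then have th_mu: "\<theta> w = sc \<mu> w" if "w \<in> W" for w using that by blast
    have "v - sc \<mu> t \<notin> span T"
    proof
      assume "v - sc \<mu> t \<in> span T"
      then have "v - sc \<mu> t \<in> span (insert t T)" using span_mono[of T "insert t T"] by blast
      moreover have "sc \<mu> t \<in> span (insert t T)" by (intro span_scale span_base) simp
      ultimately have "v - sc \<mu> t + sc \<mu> t \<in> span (insert t T)" by (rule span_add)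
      then show False using insert.prems by simp
    qed
    moreover have "v - sc \<mu> t \<in> W" using insert.prems tW by (simp add: W_diff W_scale)
    ultimately obtain a where a: "a \<in> ?J" "a \<odot> (v - sc \<mu> t) \<noteq> 0"
      using insert.IH[OF TW] by blast
    moreover have "a \<odot> v = sc \<mu> (a \<odot> t)"
      using th[OF a(1)] th_mu[of "a \<odot> t"] a tW by (simp add: W_mul)
    ultimately show False using vA tA by (simp add: mul_diff_right A_scale mul_scale_right)
  qed
qed

end

context differential_algebra
begin

text \<open>
  The relation \<open>u 0 0 \<noteq> 0\<close> makes the units linearly independent, see \<open>matrix_units_independent\<close>.
\<close>

definition matrix_units :: "nat \<Rightarrow> (nat \<Rightarrow> nat \<Rightarrow> 'a) \<Rightarrow> bool" where
  "matrix_units n u \<longleftrightarrow> n \<ge> 1 \<and> (\<forall>i<n. \<forall>j<n. u i j \<in> A) \<and> u 0 0 \<noteq> 0 \<and>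
     (\<forall>i<n. \<forall>j<n. \<forall>k<n. \<forall>l<n. u i j \<odot> u k l = (if j = k then u i l else 0)) \<and>
     one = (\<Sum>i<n. u i i) \<and>
     (\<forall>a\<in>A. \<exists>M. a = (\<Sum>i<n. \<Sum>j<n. sc (M i j) (u i j)))"

end

context differential_algebra_ideal
begin

definition annihilator :: "'a set" where
  "annihilator = {a \<in> A. \<forall>w\<in>W. a \<odot> w = 0}"

lemma annihilator_A: "x \<in> annihilator \<Longrightarrow> x \<in> A"
  and annihilator_W: "x \<in> annihilator \<Longrightarrow> w \<in> W \<Longrightarrow> x \<odot> w = 0"
  by (auto simp: annihilator_def)

lemma annihilator_subspace: "subspace annihilator"
  by (auto simp: annihilator_def subspace_def A_intros mul_zero W_A mul_add_left mul_scale_left)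

lemma annihilator_mul:
  assumes "a \<in> A" "x \<in> annihilator"
  shows "a \<odot> x \<in> annihilator" "x \<odot> a \<in> annihilator"
  using assms by (auto simp: annihilator_def A_intros mul_assoc W_A W_mul mul_zero)

text \<open>
  The annihilator \<open>K\<close> of \<open>W\<close> is a two-sided ideal.  If \<open>\<delta> x\<close> acts nontrivially on \<open>W\<close> for some \<open>x \<in> K\<close>, then a
  multiple \<open>z = p x \<in> K\<close> has a derivative fixing some \<open>w \<noteq> 0\<close> in \<open>W\<close>.  Each factor of \<open>z\<^sup>m\<close> has to be
  differentiated before the product leaves \<open>K\<close>, so \<open>\<delta>\<^sup>m(z\<^sup>m) w = m! (\<delta> z)\<^sup>m w = m! w\<close>.  In characteristic
  0 this is nonzero for all \<open>m\<close>, against the nilpotency of \<open>\<delta>\<close>.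
\<close>

lemma der_annihilator:
  assumes x: "x \<in> annihilator"
  shows "\<delta> x \<in> annihilator"
proof (rule ccontr)
  assume "\<delta> x \<notin> annihilator"
  note xA = annihilator_A[OF x]
  with \<open>\<delta> x \<notin> annihilator\<close> obtain w where w: "w \<in> W" "\<delta> x \<odot> w \<noteq> 0"
    by (auto simp: annihilator_def A_intros)
  note wA = W_A[OF w(1)]
  obtain p where p: "p \<in> A" "p \<odot> (\<delta> x \<odot> w) = w"
    using W_transitive[of "\<delta> x \<odot> w" w] w xA by (auto simp: W_mul A_intros)
  define z where "z = p \<odot> x"
  have z: "z \<in> annihilator" and zA: "z \<in> A"
    using annihilator_mul(1)[OF p(1) x] annihilator_A by (auto simp: z_def)
  have "\<delta> z \<odot> w = \<delta> p \<odot> (x \<odot> w) + p \<odot> (\<delta> x \<odot> w)"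
    using p xA wA by (simp add: z_def der_mul mul_add_left mul_assoc A_intros)
  then have zw: "\<delta> z \<odot> w = w"
    using p w x by (simp add: annihilator_W mul_zero A_intros)
  define y where "y m = (mul z ^^ m) one" for m
  have yA: "y m \<in> A" for m
    by (induction m) (auto simp: y_def zA A_intros)
  have "(\<forall>k<m. (\<delta> ^^ k) (y m) \<in> annihilator) \<and> (\<delta> ^^ m) (y m) \<odot> w = sc (fact m) w" for m
  proof (induction m)
    case 0
    show ?case using wA by (simp add: y_def one_left)
  next
    case (Suc m)
    have y: "y (Suc m) = z \<odot> y m" by (simp add: y_def)
    let ?t = "\<lambda>k i. (\<delta> ^^ i) z \<odot> (\<delta> ^^ (k - i)) (y m)"
    have tA: "?t k i \<in> A" for k i
      using zA yA by (intro mul_closed derpow_closed)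
    \<comment> \<open>of the Leibniz terms for \<open>z \<cdot> z\<^sup>m\<close>, only the one with exactly one derivative on \<open>z\<close> and all the others on \<open>z\<^sup>m\<close> can leave \<open>K\<close>\<close>
    have t_ann: "?t k i \<in> annihilator" if "i = 0 \<or> i \<le> k \<and> k - i < m" for i k
      using that annihilator_mul Suc.IH zA yA z derpow_closed by auto
    have "(\<delta> ^^ k) (y (Suc m)) \<in> annihilator" if k: "k < Suc m" for k
      unfolding y Leibniz[OF zA yA]
    proof (intro subspace_sum[OF annihilator_subspace] subspace_scale[OF annihilator_subspace])
      fix i assume "i \<in> {..k}"
      then show "?t k i \<in> annihilator" using k t_ann[of i k] by (cases "i = 0") auto
    qed
    moreover have "(\<delta> ^^ Suc m) (y (Suc m)) \<odot> w = sc (fact (Suc m)) w"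
    proof -
      have "(\<delta> ^^ Suc m) (y (Suc m)) \<odot> w =
          (\<Sum>i\<le>Suc m. sc (of_nat (Suc m choose i)) (?t (Suc m) i \<odot> w))"
        unfolding y Leibniz[OF zA yA]
        by (subst mul_sum_left) (auto intro!: A_scale tA wA sum.cong simp: mul_scale_left tA wA)
      also have "\<dots> = (\<Sum>i\<in>{1}. sc (of_nat (Suc m choose i)) (?t (Suc m) i \<odot> w))"
      proof (rule sum.mono_neutral_right)
        show "\<forall>i\<in>{..Suc m} - {1}. sc (of_nat (Suc m choose i)) (?t (Suc m) i \<odot> w) = 0"
        proof
          fix i assume "i \<in> {..Suc m} - {1}"
          then have "?t (Suc m) i \<in> annihilator" by (intro t_ann) auto
          then show "sc (of_nat (Suc m choose i)) (?t (Suc m) i \<odot> w) = 0"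
            using annihilator_W w by simp
        qed
      qed auto
      also have "\<dots> = sc (of_nat (Suc m)) (\<delta> z \<odot> sc (fact m) w)"
        using Suc.IH zA yA wA derpow_closed[of "y m" m] by (simp add: mul_assoc A_intros)
      also have "\<dots> = sc (fact (Suc m)) w"
        using zA wA zw by (simp add: mul_scale_right A_intros)
      finally show ?thesis .
    qed
    ultimately show ?case by blast
  qed
  then have power: "(\<delta> ^^ m) (y m) \<odot> w = sc (fact m) w" for m by blast
  obtain N where "\<forall>a\<in>A. (\<delta> ^^ N) a = 0" using der_uniformly_nilpotent by blast
  then have "sc (fact N) w = 0"
    using power[of N] yA wA by (simp add: mul_zero)
  then have "w = 0" by simp
  then show False using w xA by (simp add: mul_zero A_intros)
qed

text \<open>
  Differential simplicity together with \<open>der_annihilator\<close> makes \<open>A\<close> act faithfully on \<open>W\<close>.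
\<close>

lemma annihilator_trivial: "annihilator = {0}"
proof -
  obtain w where "w \<in> W" "w \<noteq> 0" using W_nonzero by blast
  then have "one \<notin> annihilator"
    using annihilator_W[of one w] W_A by (auto simp: one_left)
  moreover have "annihilator = {0} \<or> annihilator = A"
    by (rule der_simple) (auto simp: annihilator_subspace annihilator_A annihilator_mul der_annihilator)
  ultimately show ?thesis using one_closed by blast
qed

lemma faithful_W:
  assumes "a \<in> A" "a' \<in> A" "\<And>w. w \<in> W \<Longrightarrow> a \<odot> w = a' \<odot> w"
  shows "a = a'"
proof -
  have "a - a' \<in> annihilator"
    using assms W_A by (auto simp: annihilator_def A_intros mul_diff_left)
  then show ?thesis using annihilator_trivial by simp
qed

lemma faithful_basis:
  assumes "a \<in> A" "a' \<in> A" "B \<subseteq> W" "W \<subseteq> span B" "\<And>b. b \<in> B \<Longrightarrow> a \<odot> b = a' \<odot> b"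
  shows "a = a'"
proof (rule faithful_W[OF assms(1,2)])
  have "subspace {w \<in> W. a \<odot> w = a' \<odot> w}"
    using assms W_A
    by (auto simp: subspace_def W_zero W_add W_scale mul_zero mul_add_right mul_scale_right)
  then have "span B \<subseteq> {w \<in> W. a \<odot> w = a' \<odot> w}"
    using assms by (intro span_minimal) auto
  then show "a \<odot> w = a' \<odot> w" if "w \<in> W" for w
    using that assms(4) by blast
qed

lemma elementary_operators:
  assumes B: "finite B" "B \<subseteq> W" "independent B" and "b \<in> B" "w \<in> W"
  obtains a where "a \<in> A" "\<And>b'. b' \<in> B \<Longrightarrow> a \<odot> b' = (if b' = b then w else 0)"
proof -
  have "b \<notin> span (B - {b})" using B \<open>b \<in> B\<close> by (auto simp: dependent_def)
  then obtain a where a: "a \<in> A" "\<forall>t\<in>B - {b}. a \<odot> t = 0" "a \<odot> b \<noteq> 0"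
    using density[of "B - {b}" b] B \<open>b \<in> B\<close> by auto
  have "a \<odot> b \<in> W" using a B \<open>b \<in> B\<close> by (auto simp: W_mul)
  then obtain c where c: "c \<in> A" "c \<odot> (a \<odot> b) = w"
    using W_transitive a(3) \<open>w \<in> W\<close> by metis
  show thesis
  proof
    show "c \<odot> a \<in> A" using a c by (simp add: A_intros)
    show "(c \<odot> a) \<odot> b' = (if b' = b then w else 0)" if "b' \<in> B" for b'
      using that a c B W_A by (auto simp: mul_assoc mul_zero)
  qed
qed

lemma matrix_units_from_basis: "\<exists>n u. matrix_units n u"
proof -
  obtain S where S: "finite S" "W \<subseteq> span S" using W_finite by blast
  obtain B where B: "B \<subseteq> W" "independent B" "W \<subseteq> span B"
    by (rule maximal_independent_subset)
  have finB: "finite B"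
    using independent_span_bound[OF S(1) B(2)] B(1) S(2) by blast
  define n where "n = card B"
  obtain b where b: "bij_betw b {0..<n} B"
    using ex_bij_betw_nat_finite[OF finB] unfolding n_def by blast
  have bB: "i < n \<Longrightarrow> b i \<in> B" and b_eq: "i < n \<Longrightarrow> j < n \<Longrightarrow> b i = b j \<longleftrightarrow> i = j" for i j
    using b by (auto simp: bij_betw_def inj_on_def)
  have Bb: "\<exists>i<n. x = b i" if "x \<in> B" for x
    using b that by (auto simp: bij_betw_def)
  have bA: "i < n \<Longrightarrow> b i \<in> A" for i using bB B W_A by blast
  have "\<exists>a\<in>A. \<forall>k<n. a \<odot> b k = (if k = j then b i else 0)" if ij: "i < n" "j < n" for i j
  proof -
    obtain a where "a \<in> A" "\<And>b'. b' \<in> B \<Longrightarrow> a \<odot> b' = (if b' = b j then b i else 0)"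
      using elementary_operators[OF finB B(1,2) bB[OF ij(2)], of "b i"] bB[OF ij(1)] B(1) by blast
    then show ?thesis using bB b_eq ij by (intro bexI[of _ a]) auto
  qed
  note ex = this
  define u where "u i j = (SOME a. a \<in> A \<and> (\<forall>k<n. a \<odot> b k = (if k = j then b i else 0)))" for i j
  have "u i j \<in> A \<and> (\<forall>k<n. u i j \<odot> b k = (if k = j then b i else 0))" if "i < n" "j < n" for i j
    unfolding u_def by (rule someI_ex) (use ex[OF that] in blast)
  then have uA: "\<And>i j. i < n \<Longrightarrow> j < n \<Longrightarrow> u i j \<in> A"
    and ub: "\<And>i j k. i < n \<Longrightarrow> j < n \<Longrightarrow> k < n \<Longrightarrow> u i j \<odot> b k = (if k = j then b i else 0)"
    by blast+
  have eqI: "a = a'" if "a \<in> A" "a' \<in> A" "\<And>k. k < n \<Longrightarrow> a \<odot> b k = a' \<odot> b k" for a a'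
    using faithful_basis[OF that(1,2) B(1,3)] Bb that(3) by blast
  have "B \<noteq> {}" using W_nonzero B by auto
  then have n: "n \<ge> 1" using finB by (simp add: n_def Suc_le_eq card_gt_0_iff)
  have "matrix_units n u"
    unfolding matrix_units_def
  proof (intro conjI allI impI ballI n uA)
    show "u 0 0 \<noteq> 0"
    proof
      assume "u 0 0 = 0"
      then have "b 0 = 0" using ub[of 0 0 0] n bA[of 0] by (simp add: mul_zero)
      then show False using bB[of 0] n B(2) dependent_zero by auto
    qed
  next
    fix i j k l assume ijkl: "i < n" "j < n" "k < n" "l < n"
    show "u i j \<odot> u k l = (if j = k then u i l else 0)"
    proof (rule eqI)
      fix m assume m: "m < n"
      have "(u i j \<odot> u k l) \<odot> b m = u i j \<odot> (u k l \<odot> b m)"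
        using ijkl m by (simp add: mul_assoc uA bA)
      also have "\<dots> = (if j = k then u i l else 0) \<odot> b m"
        using ijkl m by (cases "m = l") (simp_all add: ub uA bA mul_zero)
      finally show "(u i j \<odot> u k l) \<odot> b m = (if j = k then u i l else 0) \<odot> b m" .
    qed (use ijkl in \<open>simp_all add: uA mul_closed A_zero\<close>)
  next
    show "one = (\<Sum>i<n. u i i)"
    proof (rule eqI)
      fix k assume k: "k < n"
      have "(\<Sum>i<n. u i i) \<odot> b k = (\<Sum>i<n. if i = k then b k else 0)"
        using k by (subst mul_sum_left) (auto simp: uA ub bA intro!: sum.cong)
      then show "one \<odot> b k = (\<Sum>i<n. u i i) \<odot> b k"
        using k bA by (simp add: one_left)
    qed (auto intro!: A_intros uA)
  next
    fix a assume a: "a \<in> A"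
    have "\<exists>c. a \<odot> b j = (\<Sum>i<n. sc (c i) (b i))" if j: "j < n" for j
    proof -
      have "a \<odot> b j \<in> span B" using a j bB B W_mul by blast
      then obtain c where "a \<odot> b j = (\<Sum>x\<in>B. sc (c x) x)"
        unfolding span_finite[OF finB] by (elim rangeE)
      also have "\<dots> = (\<Sum>i\<in>{0..<n}. sc (c (b i)) (b i))"
        by (rule sum.reindex_bij_betw[OF b, symmetric])
      finally show ?thesis by (auto simp: atLeast0LessThan)
    qed
    then obtain c where c: "\<And>j. j < n \<Longrightarrow> a \<odot> b j = (\<Sum>i<n. sc (c j i) (b i))" by metis
    have "a = (\<Sum>i<n. \<Sum>j<n. sc (c j i) (u i j))"
    proof (rule eqI)
      fix k assume k: "k < n"
      have "(\<Sum>i<n. \<Sum>j<n. sc (c j i) (u i j)) \<odot> b k = (\<Sum>i<n. (\<Sum>j<n. sc (c j i) (u i j)) \<odot> b k)"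
        by (rule mul_sum_left) (auto intro!: A_sum A_scale uA bA k)
      also have "\<dots> = (\<Sum>i<n. \<Sum>j<n. sc (c j i) (u i j \<odot> b k))"
        by (intro sum.cong refl, subst mul_sum_left)
          (auto intro!: A_scale uA bA k sum.cong simp: mul_scale_left uA bA k)
      also have "\<dots> = (\<Sum>i<n. \<Sum>j<n. if j = k then sc (c j i) (b i) else 0)"
        using k by (intro sum.cong refl) (auto simp: ub)
      also have "\<dots> = a \<odot> b k" using k by (simp add: c)
      finally show "a \<odot> b k = (\<Sum>i<n. \<Sum>j<n. sc (c j i) (u i j)) \<odot> b k" by simp
    qed (auto intro!: A_intros uA a)
    then show "\<exists>M. a = (\<Sum>i<n. \<Sum>j<n. sc (M i j) (u i j))"
      by (intro exI[of _ "\<lambda>i j. c j i"])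
  qed auto
  then show ?thesis by blast
qed

end

context differential_algebra
begin

lemma matrix_units_exist: "\<exists>n u. matrix_units n u"
proof -
  obtain W where "minimal_left_ideal W" using minimal_left_ideal_exists by blast
  then interpret differential_algebra_ideal sc A mul one \<delta> W by unfold_locales
  show ?thesis by (rule matrix_units_from_basis)
qed

text \<open>
  The classical formula \<open>d = \<Sum>\<^sub>i \<delta>(u\<^sub>i\<^sub>0) u\<^sub>0\<^sub>i\<close>.  Applying \<open>\<delta>\<close> to \<open>u\<^sub>k\<^sub>l u\<^sub>i\<^sub>0\<close> and using
  \<open>\<Sum>\<^sub>i u\<^sub>i\<^sub>0 u\<^sub>0\<^sub>i = 1\<close> gives \<open>\<delta>(u\<^sub>k\<^sub>l) = d u\<^sub>k\<^sub>l - u\<^sub>k\<^sub>l d\<close>.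
\<close>

lemma derivation_inner: "\<exists>d\<in>A. \<forall>a\<in>A. \<delta> a = d \<odot> a - a \<odot> d"
proof -
  obtain n u where "matrix_units n u" using matrix_units_exist by blast
  then have n: "0 < n" and uA: "\<And>i j. i < n \<Longrightarrow> j < n \<Longrightarrow> u i j \<in> A"
    and uu: "\<And>i j k l. i < n \<Longrightarrow> j < n \<Longrightarrow> k < n \<Longrightarrow> l < n \<Longrightarrow>
      u i j \<odot> u k l = (if j = k then u i l else 0)"
    and one: "one = (\<Sum>i<n. u i i)"
    and spanning: "\<And>a. a \<in> A \<Longrightarrow> \<exists>M. a = (\<Sum>i<n. \<Sum>j<n. sc (M i j) (u i j))"
    unfolding matrix_units_def by auto
  define d where "d = (\<Sum>i<n. \<delta> (u i 0) \<odot> u 0 i)"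
  have dA: "d \<in> A"
    unfolding d_def using n uA by (intro A_intros) auto
  have unit: "\<delta> (u k l) = d \<odot> u k l - u k l \<odot> d" if kl: "k < n" "l < n" for k l
  proof -
    have du: "\<delta> (u i j) \<in> A" if "i < n" "j < n" for i j using that uA by (simp add: A_intros)
    have "d \<odot> u k l = (\<Sum>i<n. \<delta> (u i 0) \<odot> u 0 i \<odot> u k l)"
      unfolding d_def using n kl uA du by (subst mul_sum_left) (auto simp: A_intros)
    also have "\<dots> = (\<Sum>i<n. if i = k then \<delta> (u k 0) \<odot> u 0 l else 0)"
      using n kl uA du by (intro sum.cong) (auto simp: mul_assoc uu mul_zero)
    finally have left: "d \<odot> u k l = \<delta> (u k 0) \<odot> u 0 l" using kl by simp
    have "u k l \<odot> d = (\<Sum>i<n. u k l \<odot> (\<delta> (u i 0) \<odot> u 0 i))"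
      unfolding d_def using n kl uA du by (subst mul_sum_right) (auto simp: A_intros)
    also have "\<dots> = (\<Sum>i<n. (if i = l then \<delta> (u k 0) \<odot> u 0 i else 0) - \<delta> (u k l) \<odot> u i i)"
    proof (intro sum.cong refl)
      fix i assume "i \<in> {..<n}"
      then have i: "i < n" by simp
      have "\<delta> (u k l \<odot> u i 0) = \<delta> (u k l) \<odot> u i 0 + u k l \<odot> \<delta> (u i 0)"
        using i n kl uA by (simp add: der_mul)
      then have *: "u k l \<odot> \<delta> (u i 0) = (if i = l then \<delta> (u k 0) else 0) - \<delta> (u k l) \<odot> u i 0"
        using i n kl by (auto simp: uu der_zero algebra_simps split: if_splits)
      have "u k l \<odot> (\<delta> (u i 0) \<odot> u 0 i) = (u k l \<odot> \<delta> (u i 0)) \<odot> u 0 i"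
        using i n kl uA du by (simp add: mul_assoc)
      also have "\<dots> = (if i = l then \<delta> (u k 0) \<odot> u 0 i else 0) - \<delta> (u k l) \<odot> (u i 0 \<odot> u 0 i)"
        unfolding * using i n kl uA du
        by (auto simp: mul_diff_left mul_assoc mul_zero A_intros)
      finally show "u k l \<odot> (\<delta> (u i 0) \<odot> u 0 i) =
          (if i = l then \<delta> (u k 0) \<odot> u 0 i else 0) - \<delta> (u k l) \<odot> u i i"
        using i n by (simp add: uu)
    qed
    also have "\<dots> = \<delta> (u k 0) \<odot> u 0 l - \<delta> (u k l) \<odot> one"
      unfolding one using kl uA du by (subst mul_sum_right) (auto simp: sum_subtractf)
    finally show ?thesis using left kl uA du by (simp add: one_right)
  qed
  have "subspace {a \<in> A. \<delta> a = d \<odot> a - a \<odot> d}"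
    using dA
    by (auto simp: subspace_def A_intros der_zero mul_zero der_add der_scale
        mul_add_left mul_add_right mul_scale_left mul_scale_right scale_right_diff_distrib)
  then have "(\<Sum>i<n. \<Sum>j<n. sc (M i j) (u i j)) \<in> {a \<in> A. \<delta> a = d \<odot> a - a \<odot> d}" for M
    using uA unit by (intro subspace_sum subspace_scale) auto
  note comb = this
  have "\<delta> a = d \<odot> a - a \<odot> d" if a: "a \<in> A" for a
  proof -
    obtain M where "a = (\<Sum>i<n. \<Sum>j<n. sc (M i j) (u i j))"
      using spanning[OF a] by (elim exE)
    then show ?thesis using comb[of M] by simp
  qed
  then show ?thesis using dA by (intro bexI[of _ d]) auto
qed

text \<open>
  The element implementing \<open>\<delta>\<close> is determined up to a scalar, which is chosen so that \<open>d v = 0\<close> for some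
  \<open>v \<noteq> 0\<close> in the minimal left ideal.  Then \<open>\<delta>\<^sup>k(a) v = d\<^sup>k a v\<close>, and since \<open>W\<close> consists of the \<open>a v\<close>,
  \<open>\<delta>\<^sup>N = 0\<close> forces \<open>d\<^sup>N\<close> to vanish on \<open>W\<close>.
\<close>

lemma derivation_inner_nilpotent:
  obtains d N where "d \<in> A" "\<And>a. a \<in> A \<Longrightarrow> \<delta> a = d \<odot> a - a \<odot> d" "(mul d ^^ N) one = 0"
proof -
  obtain W where "minimal_left_ideal W" using minimal_left_ideal_exists by blast
  then interpret differential_algebra_ideal sc A mul one \<delta> W by unfold_locales
  obtain d0 where d0: "d0 \<in> A" "\<And>a. a \<in> A \<Longrightarrow> \<delta> a = d0 \<odot> a - a \<odot> d0"
    using derivation_inner by blast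
  obtain S where S: "finite S" "W \<subseteq> span S" using W_finite by blast
  obtain w where w: "w \<in> W" "w \<noteq> 0" using W_nonzero by blast
  obtain \<mu> v where v: "v \<in> W" "v \<noteq> 0" "d0 \<odot> v = sc \<mu> v"
    by (rule eigenvector_exists[OF vector_space_axioms W_subspace S, of "mul d0" w])
      (use d0 w W_A in \<open>auto simp: W_mul mul_add_right mul_scale_right\<close>)
  note vA = W_A[OF v(1)]
  define d where "d = d0 - sc \<mu> one"
  have dA: "d \<in> A" using d0 by (simp add: d_def A_intros)
  have dv: "d \<odot> v = 0"
    using d0 v vA by (simp add: d_def mul_diff_left mul_scale_left one_left A_intros)
  have d: "\<delta> a = d \<odot> a - a \<odot> d" if "a \<in> A" for a
    using that d0
    by (simp add: d_def mul_diff_left mul_diff_right mul_scale_left mul_scale_right one_left one_right A_intros)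
  have pow_closed: "(mul d ^^ k) x \<in> A" if "x \<in> A" for k x
    using that dA by (induction k) (auto intro: A_intros)
  have act: "(\<delta> ^^ k) a \<odot> v = (mul d ^^ k) (a \<odot> v)" if "a \<in> A" for k a
    using that
  proof (induction k arbitrary: a)
    case (Suc k)
    have "(\<delta> ^^ Suc k) a \<odot> v = \<delta> ((\<delta> ^^ k) a) \<odot> v" by simp
    also have "\<dots> = d \<odot> ((\<delta> ^^ k) a \<odot> v) - (\<delta> ^^ k) a \<odot> (d \<odot> v)"
      using Suc.prems dA vA by (simp add: d derpow_closed mul_diff_left mul_assoc A_intros)
    also have "\<dots> = (mul d ^^ Suc k) (a \<odot> v)"
      using Suc by (simp add: dv mul_zero derpow_closed)
    finally show ?case .
  qed simp
  obtain N where N: "\<forall>a\<in>A. (\<delta> ^^ N) a = 0" using der_uniformly_nilpotent by blast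
  have pow_assoc: "(mul d ^^ k) one \<odot> x = (mul d ^^ k) x" if "x \<in> A" for k x
    using that dA one_closed by (induction k) (auto simp: one_left mul_assoc pow_closed)
  have "(mul d ^^ N) one = 0"
  proof (rule faithful_W)
    fix x assume x: "x \<in> W"
    then obtain a where "a \<in> A" "a \<odot> v = x" using W_transitive v by metis
    then show "(mul d ^^ N) one \<odot> x = 0 \<odot> x"
      using act[of a N] N vA W_A[OF x] by (simp add: mul_zero pow_assoc)
  qed (auto simp: pow_closed one_closed A_zero)
  then show thesis using that dA d by blast
qed

end

context differential_algebra
begin

text \<open>
  Multiplying by \<open>u 0 i\<close> on the left and by \<open>u j 0\<close> on the right isolates the coefficient \<open>M i j\<close>.
\<close>

lemma matrix_units_independent:
  assumes u: "matrix_units n u" and zero: "(\<Sum>i<n. \<Sum>j<n. sc (M i j) (u i j)) = 0"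
    and ij: "i < n" "j < n"
  shows "M i j = 0"
proof -
  have n: "0 < n" and uA: "\<And>i j. i < n \<Longrightarrow> j < n \<Longrightarrow> u i j \<in> A" and u0: "u 0 0 \<noteq> 0"
    and uu: "\<And>i j k l. i < n \<Longrightarrow> j < n \<Longrightarrow> k < n \<Longrightarrow> l < n \<Longrightarrow>
      u i j \<odot> u k l = (if j = k then u i l else 0)"
    using u unfolding matrix_units_def by auto
  have cu: "sc (M k l) (u k l) \<in> A" if "k < n" "l < n" for k l
    using that uA by (simp add: A_scale)
  have "u 0 i \<odot> (\<Sum>k<n. \<Sum>l<n. sc (M k l) (u k l)) \<odot> u j 0 =
      (\<Sum>k<n. \<Sum>l<n. u 0 i \<odot> sc (M k l) (u k l) \<odot> u j 0)"
  proof -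
    have "u 0 i \<odot> (\<Sum>k<n. \<Sum>l<n. sc (M k l) (u k l)) = (\<Sum>k<n. u 0 i \<odot> (\<Sum>l<n. sc (M k l) (u k l)))"
      using cu uA n ij by (intro mul_sum_right A_sum) auto
    also have "\<dots> = (\<Sum>k<n. \<Sum>l<n. u 0 i \<odot> sc (M k l) (u k l))"
      using cu uA n ij by (intro sum.cong mul_sum_right) auto
    also have "\<dots> \<odot> u j 0 = (\<Sum>k<n. (\<Sum>l<n. u 0 i \<odot> sc (M k l) (u k l)) \<odot> u j 0)"
      using cu uA n ij by (intro mul_sum_left A_sum mul_closed) auto
    also have "\<dots> = (\<Sum>k<n. \<Sum>l<n. u 0 i \<odot> sc (M k l) (u k l) \<odot> u j 0)"
      using cu uA n ij by (intro sum.cong mul_sum_left mul_closed) auto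
    finally show ?thesis .
  qed
  also have "\<dots> = (\<Sum>k<n. \<Sum>l<n. if l = j then (if k = i then sc (M i j) (u 0 0) else 0) else 0)"
    using uA n ij by (intro sum.cong refl)
      (auto simp: mul_scale_left mul_scale_right uu A_scale mul_zero)
  also have "\<dots> = sc (M i j) (u 0 0)" using ij by simp
  finally have "sc (M i j) (u 0 0) = 0"
    using zero uA n ij by (simp add: mul_zero)
  then show ?thesis using u0 by simp
qed

lemma matrix_units_mult:
  assumes u: "matrix_units n u"
  shows "(\<Sum>i<n. \<Sum>j<n. sc (M i j) (u i j)) \<odot> (\<Sum>i<n. \<Sum>j<n. sc (N i j) (u i j)) =
    (\<Sum>i<n. \<Sum>j<n. sc (\<Sum>k<n. M i k * N k j) (u i j))"
proof -
  have uA: "\<And>i j. i < n \<Longrightarrow> j < n \<Longrightarrow> u i j \<in> A"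
    and uu: "\<And>i j k l. i < n \<Longrightarrow> j < n \<Longrightarrow> k < n \<Longrightarrow> l < n \<Longrightarrow>
      u i j \<odot> u k l = (if j = k then u i l else 0)"
    using u unfolding matrix_units_def by auto
  have cu: "sc c (u k l) \<in> A" if "k < n" "l < n" for c k l
    using that uA by (simp add: A_scale)
  let ?N = "\<Sum>l<n. \<Sum>j<n. sc (N l j) (u l j)"
  have NA: "?N \<in> A" using cu by (intro A_sum) auto
  have row: "sc (M i k) (u i k) \<odot> ?N = (\<Sum>j<n. sc (M i k * N k j) (u i j))" if ik: "i < n" "k < n" for i k
  proof -
    have "sc (M i k) (u i k) \<odot> ?N = (\<Sum>l<n. sc (M i k) (u i k) \<odot> (\<Sum>j<n. sc (N l j) (u l j)))"
      using cu ik by (intro mul_sum_right A_sum) auto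
    also have "\<dots> = (\<Sum>l<n. \<Sum>j<n. sc (M i k) (u i k) \<odot> sc (N l j) (u l j))"
      using cu ik by (intro sum.cong mul_sum_right) auto
    also have "\<dots> = (\<Sum>l<n. if l = k then (\<Sum>j<n. sc (M i k * N k j) (u i j)) else 0)"
      using ik uA by (intro sum.cong refl)
        (auto simp: mul_scale_left mul_scale_right uu A_scale intro!: sum.neutral sum.cong)
    also have "\<dots> = (\<Sum>j<n. sc (M i k * N k j) (u i j))" using ik by simp
    finally show ?thesis .
  qed
  have "(\<Sum>i<n. \<Sum>k<n. sc (M i k) (u i k)) \<odot> ?N = (\<Sum>i<n. (\<Sum>k<n. sc (M i k) (u i k)) \<odot> ?N)"
    using cu NA by (intro mul_sum_left A_sum) auto
  also have "\<dots> = (\<Sum>i<n. \<Sum>k<n. sc (M i k) (u i k) \<odot> ?N)"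
    using cu NA by (intro sum.cong mul_sum_left) auto
  also have "\<dots> = (\<Sum>i<n. \<Sum>k<n. \<Sum>j<n. sc (M i k * N k j) (u i j))"
    by (intro sum.cong refl row) auto
  also have "\<dots> = (\<Sum>i<n. \<Sum>j<n. \<Sum>k<n. sc (M i k * N k j) (u i j))"
    by (rule sum.cong[OF refl], rule sum.swap)
  also have "\<dots> = (\<Sum>i<n. \<Sum>j<n. sc (\<Sum>k<n. M i k * N k j) (u i j))"
    by (simp add: scale_sum_left)
  finally show ?thesis .
qed

end


section \<open>From the coefficient algebra to the products\<close>

context conformal_algebra
begin

abbreviation cs :: "complex \<Rightarrow> 'c \<Rightarrow> 'c" where
  "cs c x \<equiv> smul [:c:] x"

abbreviation bd :: "'c \<Rightarrow> 'c"  ("\<partial>") where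
  "\<partial> x \<equiv> smul [:0, 1:] x"

sublocale sc: vector_space cs
  by unfold_locales (simp_all add: scale_right_distrib mult.commute flip: scale_left_distrib one_pCons)

text \<open>
  As a simplification rule, \<open>scale_scale\<close> would fuse \<open>\<partial> (smul P x)\<close> into a single polynomial action and
  hide the derivative from the laws for \<open>\<partial>\<close>.
\<close>

declare scale_scale [simp del]

lemma C_zero: "0 \<in> C"
  and C_add: "x \<in> C \<Longrightarrow> y \<in> C \<Longrightarrow> x + y \<in> C"
  and C_diff: "x \<in> C \<Longrightarrow> y \<in> C \<Longrightarrow> x - y \<in> C"
  and C_smul: "x \<in> C \<Longrightarrow> smul P x \<in> C"
  and C_sum: "(\<And>i. i \<in> I \<Longrightarrow> f i \<in> C) \<Longrightarrow> sum f I \<in> C"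
  using subspace_carrier
  by (auto intro: subspace_0 subspace_add subspace_diff subspace_scale subspace_sum)

lemmas C_intros = C_zero C_add C_diff C_smul C_sum nprod_closed

lemma nprod_zero_left: "a \<in> C \<Longrightarrow> nprod n 0 a = 0"
  using nprod_scale_left[of a a n 0] by simp

lemma nprod_zero_right: "a \<in> C \<Longrightarrow> nprod n a 0 = 0"
  using nprod_scale_right[of a a n 0] by simp

lemma nprod_diff_left: "a \<in> C \<Longrightarrow> a' \<in> C \<Longrightarrow> b \<in> C \<Longrightarrow> nprod n (a - a') b = nprod n a b - nprod n a' b"
  using nprod_add_left[of "a - a'" a' b n] by (simp add: C_diff)

lemma nprod_diff_right: "a \<in> C \<Longrightarrow> b \<in> C \<Longrightarrow> b' \<in> C \<Longrightarrow> nprod n a (b - b') = nprod n a b - nprod n a b'"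
  using nprod_add_right[of a "b - b'" b' n] by (simp add: C_diff)

lemma nprod_sum_left: "(\<And>i. i \<in> I \<Longrightarrow> f i \<in> C) \<Longrightarrow> b \<in> C \<Longrightarrow> nprod n (sum f I) b = (\<Sum>i\<in>I. nprod n (f i) b)"
  by (induction I rule: infinite_finite_induct)
    (auto simp: nprod_zero_left nprod_add_left C_sum)

lemma nprod_sum_right: "(\<And>i. i \<in> I \<Longrightarrow> f i \<in> C) \<Longrightarrow> b \<in> C \<Longrightarrow> nprod n b (sum f I) = (\<Sum>i\<in>I. nprod n b (f i))"
  by (induction I rule: infinite_finite_induct)
    (auto simp: nprod_zero_right nprod_add_right C_sum)

lemma deriv_cs: "\<partial> (cs c x) = cs c (\<partial> x)"
  by (simp add: scale_scale mult.commute)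

lemma nprod_deriv_right:
  assumes "a \<in> C" "b \<in> C"
  shows "nprod n a (\<partial> b) = \<partial> (nprod n a b) + cs (of_nat n) (nprod (n - 1) a b)"
  using deriv_nprod[OF assms, of n] nprod_deriv_left[OF assms, of n]
  by (simp add: sc.scale_minus_left algebra_simps)

text \<open>
  In this form the coefficient is free of the sum over \<open>j\<close>, since only one \<open>j\<close> contributes to \<open>t\<^sup>q\<close>.
\<close>

lemma lookup_laurent_monom_prod:
  assumes "a \<in> C" "b \<in> C"
  shows "Poly_Mapping.lookup (laurent_monom_prod a l b m) q =
    (if q \<le> l + m then cs (of_int l gchoose nat (l + m - q)) (nprod (nat (l + m - q)) a b) else 0)"
proof -
  obtain N where N: "\<forall>n\<ge>N. nprod n a b = 0" using locality[OF assms] by blast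
  have fin: "finite {j. nprod j a b \<noteq> 0}"
    by (rule finite_subset[of _ "{..<N}"]) (use N in \<open>auto simp: not_less[symmetric]\<close>)
  have "Poly_Mapping.lookup (laurent_monom_prod a l b m) q =
      (\<Sum>j | nprod j a b \<noteq> 0. if q \<le> l + m \<and> j = nat (l + m - q)
         then cs (of_int l gchoose j) (nprod j a b) else 0)"
    unfolding laurent_monom_prod_def lookup_sum
    by (intro sum.cong) (auto simp: lookup_single when_def)
  also have "\<dots> = (if q \<le> l + m then cs (of_int l gchoose nat (l + m - q)) (nprod (nat (l + m - q)) a b) else 0)"
    using fin by (auto simp: sum.delta')
  finally show ?thesis .
qed

lemma lookup_laurent_prod:
  assumes x: "x \<in> laurent" and y: "y \<in> laurent"
    and L: "finite L" "Poly_Mapping.keys x \<subseteq> L" and M: "finite M" "Poly_Mapping.keys y \<subseteq> M"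
  shows "Poly_Mapping.lookup (laurent_prod x y) q =
    (\<Sum>l\<in>L. \<Sum>m\<in>M. Poly_Mapping.lookup
       (laurent_monom_prod (Poly_Mapping.lookup x l) l (Poly_Mapping.lookup y m) m) q)"
proof -
  have xy: "Poly_Mapping.lookup x l \<in> C" "Poly_Mapping.lookup y l \<in> C" for l
    using x y by (auto simp: laurent_def)
  have zero: "laurent_monom_prod (Poly_Mapping.lookup x l) l (Poly_Mapping.lookup y m) m = 0"
    if "l \<notin> Poly_Mapping.keys x \<or> m \<notin> Poly_Mapping.keys y" for l m
    using that xy
    by (auto simp: laurent_monom_prod_def in_keys_iff nprod_zero_left nprod_zero_right)
  have "Poly_Mapping.lookup (laurent_prod x y) q =
    (\<Sum>l\<in>Poly_Mapping.keys x. \<Sum>m\<in>Poly_Mapping.keys y. Poly_Mapping.lookup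
       (laurent_monom_prod (Poly_Mapping.lookup x l) l (Poly_Mapping.lookup y m) m) q)"
    by (simp add: laurent_prod_def lookup_sum)
  also have "\<dots> = (\<Sum>l\<in>Poly_Mapping.keys x. \<Sum>m\<in>M. Poly_Mapping.lookup
       (laurent_monom_prod (Poly_Mapping.lookup x l) l (Poly_Mapping.lookup y m) m) q)"
    by (intro sum.cong refl sum.mono_neutral_left M) (auto simp: zero)
  also have "\<dots> = (\<Sum>l\<in>L. \<Sum>m\<in>M. Poly_Mapping.lookup
       (laurent_monom_prod (Poly_Mapping.lookup x l) l (Poly_Mapping.lookup y m) m) q)"
    by (intro sum.mono_neutral_left L) (auto simp: zero)
  finally show ?thesis .
qed

lemma lookup_laurent_total_deriv:
  "Poly_Mapping.lookup (laurent_total_deriv x) q =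
     \<partial> (Poly_Mapping.lookup x q) + cs (of_int (q + 1)) (Poly_Mapping.lookup x (q + 1))"
proof -
  have "Poly_Mapping.lookup (laurent_total_deriv x) q =
     (\<Sum>l\<in>Poly_Mapping.keys x. if l = q then \<partial> (Poly_Mapping.lookup x l) else 0) +
     (\<Sum>l\<in>Poly_Mapping.keys x. if l = q + 1 then cs (of_int l) (Poly_Mapping.lookup x l) else 0)"
    unfolding laurent_total_deriv_def lookup_sum sum.distrib[symmetric]
    by (intro sum.cong) (auto simp: lookup_add lookup_single when_def)
  then show ?thesis
    by (auto simp: sum.delta' in_keys_iff)
qed

lemma laurent_single: "a \<in> C \<Longrightarrow> Poly_Mapping.single l a \<in> laurent"
  by (auto simp: laurent_def lookup_single when_def C_zero)

lemma laurent_monom_prod_laurent: "a \<in> C \<Longrightarrow> b \<in> C \<Longrightarrow> laurent_monom_prod a l b m \<in> laurent"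
  by (auto simp: laurent_def lookup_laurent_monom_prod C_intros)

lemma laurent_prod_single:
  assumes "a \<in> C" "b \<in> C"
  shows "laurent_prod (Poly_Mapping.single l a) (Poly_Mapping.single m b) = laurent_monom_prod a l b m"
proof (rule poly_mapping_eqI)
  fix q
  show "Poly_Mapping.lookup (laurent_prod (Poly_Mapping.single l a) (Poly_Mapping.single m b)) q =
      Poly_Mapping.lookup (laurent_monom_prod a l b m) q"
    using assms by (subst lookup_laurent_prod[where L = "{l}" and M = "{m}"]) (auto simp: laurent_single)
qed

text \<open>
  Let \<open>(\<partial> + d/dt) w\<close> have no terms below \<open>t\<^sup>-\<^sup>1\<close>.  Its coefficients are \<open>\<partial> w\<^sub>q + (q + 1) w\<^bsub>q+1\<^esub>\<close>, so
  \<open>w\<^sub>q = 0\<close> for very negative \<open>q\<close> propagates up to \<open>q = -1\<close>.  There the factor \<open>q + 1\<close> vanishes, and the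
  coefficient is \<open>\<partial> w\<^bsub>-1\<^esub> = 0\<close>.
\<close>

lemma total_deriv_residue:
  assumes w: "w \<in> laurent"
    and neg: "\<And>q. q < - 1 \<Longrightarrow> Poly_Mapping.lookup (laurent_total_deriv w) q = 0"
  shows "Poly_Mapping.lookup (laurent_total_deriv w) (- 1) = 0"
proof -
  define b where "b = Min (insert (- 1) (Poly_Mapping.keys w)) - 1"
  have b: "b \<le> - 1" "Poly_Mapping.lookup w b = 0"
  proof -
    have "Min (insert (- 1) (Poly_Mapping.keys w)) \<le> - 1" by simp
    then show "b \<le> - 1" unfolding b_def by linarith
    have "Min (insert (- 1) (Poly_Mapping.keys w)) \<le> b" if "b \<in> Poly_Mapping.keys w"
      using that by simp
    then show "Poly_Mapping.lookup w b = 0" by (force simp: b_def in_keys_iff)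
  qed
  have "q \<le> - 1 \<longrightarrow> Poly_Mapping.lookup w q = 0" if "b \<le> q" for q
    using that
  proof (induction q rule: int_ge_induct)
    case (step q)
    show ?case
    proof
      assume q: "q + 1 \<le> - 1"
      then have "cs (of_int (q + 1)) (Poly_Mapping.lookup w (q + 1)) = 0"
        using step neg[of q] by (simp add: lookup_laurent_total_deriv)
      moreover have "(of_int (q + 1) :: complex) \<noteq> 0" using q by (simp only: of_int_eq_0_iff)
      ultimately show "Poly_Mapping.lookup w (q + 1) = 0" by (simp only: sc.scale_eq_0_iff simp_thms)
    qed
  qed (use b in simp)
  then have "Poly_Mapping.lookup w (- 1) = 0" using b by simp
  then show ?thesis by (simp add: lookup_laurent_total_deriv)
qed

text \<open>
  Compare \<open>(f t\<^sup>m \<cdot> g t\<^sup>n) \<cdot> h t\<^sup>-\<^sup>1\<close> with \<open>f t\<^sup>m \<cdot> (g t\<^sup>n \<cdot> h t\<^sup>-\<^sup>1)\<close> for \<open>m, n \<ge> 0\<close>.  As binomial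
  coefficients \<open>binom(m, j)\<close> with \<open>j > m\<close> vanish, no power below \<open>t\<^sup>-\<^sup>1\<close> occurs, and the two sides of the
  claim are the coefficients of \<open>t\<^sup>-\<^sup>1\<close>.  They agree by \<open>total_deriv_residue\<close>.
\<close>

lemma nprod_assoc:
  assumes assoc: associative_conformal and f: "f \<in> C" and g: "g \<in> C" and h: "h \<in> C"
  shows "nprod m f (nprod n g h) =
    (\<Sum>j\<le>m. cs (of_nat (m choose j)) (nprod (m + n - j) (nprod j f g) h))"
proof -
  let ?x = "Poly_Mapping.single (int m) f" and ?y = "Poly_Mapping.single (int n) g"
    and ?z = "Poly_Mapping.single (- 1) h"
  define X where "X = laurent_monom_prod f (int m) g (int n)"
  define Y where "Y = laurent_monom_prod g (int n) h (- 1)"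
  have XY: "X \<in> laurent" "Y \<in> laurent"
    using f g h by (auto simp: X_def Y_def laurent_monom_prod_laurent)
  then have XYC: "Poly_Mapping.lookup X l \<in> C" "Poly_Mapping.lookup Y l \<in> C" for l
    by (auto simp: laurent_def)
  have choose: "(of_int (int a) gchoose k :: complex) = of_nat (a choose k)" for a k
    by (simp add: binomial_gbinomial)
  have Xl: "Poly_Mapping.lookup X l = (if l \<le> int m + int n
      then cs (of_nat (m choose nat (int m + int n - l))) (nprod (nat (int m + int n - l)) f g) else 0)" for l
    unfolding X_def using f g by (subst lookup_laurent_monom_prod) (simp_all add: choose[simplified])
  have X0: "Poly_Mapping.lookup X l = 0" if "l < int n" for l
  proof -
    have "m < nat (int m + int n - l)" using that by linarith
    then show ?thesis by (simp add: Xl)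
  qed
  have Yl: "Poly_Mapping.lookup Y l = (if l \<le> int n - 1
      then cs (of_nat (n choose nat (int n - 1 - l))) (nprod (nat (int n - 1 - l)) g h) else 0)" for l
    unfolding Y_def using g h by (subst lookup_laurent_monom_prod) (simp_all add: choose[simplified])
  have Y0: "Poly_Mapping.lookup Y l = 0" if "l < - 1" for l
  proof -
    have "n < nat (int n - 1 - l)" using that by linarith
    then show ?thesis by (simp add: Yl)
  qed
  define L where "L = Poly_Mapping.keys X \<union> {int n..int m + int n}"
  define M where "M = insert (- 1) (Poly_Mapping.keys Y)"
  have left: "Poly_Mapping.lookup (laurent_prod X ?z) q = (\<Sum>l\<in>L. if q \<le> l - 1
      then cs (of_int l gchoose nat (l - 1 - q)) (nprod (nat (l - 1 - q)) (Poly_Mapping.lookup X l) h) else 0)" for q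
    using XY XYC h
    by (subst lookup_laurent_prod[where L = L and M = "{- 1}"])
      (auto simp: L_def laurent_single lookup_laurent_monom_prod intro!: sum.cong)
  have right: "Poly_Mapping.lookup (laurent_prod ?x Y) q = (\<Sum>l\<in>M. if q \<le> int m + l
      then cs (of_nat (m choose nat (int m + l - q))) (nprod (nat (int m + l - q)) f (Poly_Mapping.lookup Y l)) else 0)" for q
    using XY XYC f
    by (subst lookup_laurent_prod[where L = "{int m}" and M = M])
      (auto simp: M_def laurent_single lookup_laurent_monom_prod choose[simplified] intro!: sum.cong)
  have left_neg: "Poly_Mapping.lookup (laurent_prod X ?z) q = 0" if "q < - 1" for q
    unfolding left
  proof (rule sum.neutral, rule ballI)
    fix l
    show "(if q \<le> l - 1 then cs (of_int l gchoose nat (l - 1 - q))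
        (nprod (nat (l - 1 - q)) (Poly_Mapping.lookup X l) h) else 0) = 0"
    proof (cases "l < int n")
      case True
      then show ?thesis using h by (simp add: X0 nprod_zero_left)
    next
      case False
      then have "l = int (nat l)" by simp
      then have "(of_int l gchoose nat (l - 1 - q) :: complex) = of_nat (nat l choose nat (l - 1 - q))"
        using choose by metis
      also have "\<dots> = 0" using False \<open>q < - 1\<close> by simp
      finally show ?thesis by simp
    qed
  qed
  have right_neg: "Poly_Mapping.lookup (laurent_prod ?x Y) q = 0" if "q < - 1" for q
    unfolding right
  proof (rule sum.neutral, rule ballI)
    fix l
    show "(if q \<le> int m + l then cs (of_nat (m choose nat (int m + l - q)))
        (nprod (nat (int m + l - q)) f (Poly_Mapping.lookup Y l)) else 0) = 0"
    proof (cases "l < - 1")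
      case False
      then have "m < nat (int m + l - q)" using \<open>q < - 1\<close> by linarith
      then show ?thesis by simp
    qed (use f in \<open>simp add: Y0 nprod_zero_right\<close>)
  qed
  have "Poly_Mapping.lookup (laurent_prod ?x Y) (- 1) = (\<Sum>l\<in>{- 1 :: int}. nprod m f (nprod n g h))"
    unfolding right
  proof (rule sum.mono_neutral_cong_right)
    show "\<forall>l\<in>M - {- 1}. (if - 1 \<le> int m + l then cs (of_nat (m choose nat (int m + l - - 1)))
        (nprod (nat (int m + l - - 1)) f (Poly_Mapping.lookup Y l)) else 0) = 0"
    proof
      fix l assume "l \<in> M - {- 1}"
      then have "l < - 1 \<or> m < nat (int m + l - - 1)" by auto
      then show "(if - 1 \<le> int m + l then cs (of_nat (m choose nat (int m + l - - 1)))
        (nprod (nat (int m + l - - 1)) f (Poly_Mapping.lookup Y l)) else 0) = 0"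
        using f by (elim disjE) (simp_all add: Y0 nprod_zero_right)
    qed
  qed (auto simp: M_def Yl)
  then have right_res: "Poly_Mapping.lookup (laurent_prod ?x Y) (- 1) = nprod m f (nprod n g h)"
    by simp
  have "Poly_Mapping.lookup (laurent_prod X ?z) (- 1) =
      (\<Sum>l\<in>{int n..int m + int n}. nprod (nat l) (Poly_Mapping.lookup X l) h)"
    unfolding left
  proof (rule sum.mono_neutral_cong_right)
    show "\<forall>l\<in>L - {int n..int m + int n}. (if - 1 \<le> l - 1 then cs (of_int l gchoose nat (l - 1 - - 1))
        (nprod (nat (l - 1 - - 1)) (Poly_Mapping.lookup X l) h) else 0) = 0"
    proof
      fix l assume "l \<in> L - {int n..int m + int n}"
      then have "Poly_Mapping.lookup X l = 0" by (auto simp: X0 Xl)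
      then show "(if - 1 \<le> l - 1 then cs (of_int l gchoose nat (l - 1 - - 1))
        (nprod (nat (l - 1 - - 1)) (Poly_Mapping.lookup X l) h) else 0) = 0"
        using h by (simp add: nprod_zero_left)
    qed
  next
    fix l assume l: "l \<in> {int n..int m + int n}"
    then have "(of_int l gchoose nat l :: complex) = of_nat (nat l choose nat l)"
      using choose[of "nat l" "nat l"] by simp
    then show "(if - 1 \<le> l - 1 then cs (of_int l gchoose nat (l - 1 - - 1))
        (nprod (nat (l - 1 - - 1)) (Poly_Mapping.lookup X l) h) else 0) =
        nprod (nat l) (Poly_Mapping.lookup X l) h"
      using l by simp
  qed (auto simp: L_def)
  also have "\<dots> = (\<Sum>j\<le>m. nprod (m + n - j) (Poly_Mapping.lookup X (int m + int n - int j)) h)"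
    by (rule sum.reindex_bij_witness[of _ "\<lambda>j. int m + int n - int j" "\<lambda>l. nat (int m + int n - l)"])
      (auto simp: nat_diff_distrib' nat_add_distrib)
  also have "\<dots> = (\<Sum>j\<le>m. cs (of_nat (m choose j)) (nprod (m + n - j) (nprod j f g) h))"
    using f g h by (intro sum.cong refl) (simp add: Xl nprod_scale_left nprod_closed)
  finally have left_res: "Poly_Mapping.lookup (laurent_prod X ?z) (- 1) =
      (\<Sum>j\<le>m. cs (of_nat (m choose j)) (nprod (m + n - j) (nprod j f g) h))" .
  have "laurent_prod (laurent_prod ?x ?y) ?z - laurent_prod ?x (laurent_prod ?y ?z)
      \<in> laurent_total_deriv ` laurent"
    using assoc laurent_single[OF f] laurent_single[OF g] laurent_single[OF h]
    unfolding associative_conformal_def by blast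
  then have "laurent_prod X ?z - laurent_prod ?x Y \<in> laurent_total_deriv ` laurent"
    using f g h by (simp add: laurent_prod_single X_def Y_def)
  then obtain w where w: "w \<in> laurent" and eq: "laurent_prod X ?z - laurent_prod ?x Y = laurent_total_deriv w"
    by blast
  have "Poly_Mapping.lookup (laurent_total_deriv w) (- 1) = 0"
    by (rule total_deriv_residue[OF w]) (simp add: left_neg right_neg lookup_minus flip: eq)
  then show ?thesis
    by (simp add: left_res right_res lookup_minus flip: eq)
qed

end

section \<open>The constants of a conformal identity\<close>

context conformal_algebra
begin

lemma smul_pCons: "smul (pCons c P) x = cs c x + \<partial> (smul P x)"
proof -
  have "pCons c P = [:c:] + [:0, 1:] * P" by simp
  then show ?thesis by (metis scale_left_distrib scale_scale)
qed

lemma subspace_from_generators: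
  assumes "0 \<in> J" and "\<And>x y. x \<in> J \<Longrightarrow> y \<in> J \<Longrightarrow> x + y \<in> J"
    and "\<And>c x. x \<in> J \<Longrightarrow> cs c x \<in> J" and "\<And>x. x \<in> J \<Longrightarrow> \<partial> x \<in> J"
  shows "subspace J"
proof -
  have "smul P x \<in> J" if "x \<in> J" for P x
  proof (induction P)
    case (pCons c P)
    then show ?case unfolding smul_pCons[of c P] using assms that by blast
  qed (use assms in simp)
  then show ?thesis using assms by (auto simp: subspace_def)
qed

end

text \<open>
  The conformal identity is a parameter, so that the theory applies to a second identity as well.
\<close>

locale unital_associative = conformal_algebra smul C nprod
  for smul :: "complex poly \<Rightarrow> 'c::ab_group_add \<Rightarrow> 'c" and C nprod +
  fixes e :: 'c
  assumes identity: "conformal_identity e" and associative: associative_conformal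
begin

lemma e_C: "e \<in> C"
  and e_left: "x \<in> C \<Longrightarrow> nprod 0 e x = x"
  and e_higher: "n \<ge> 1 \<Longrightarrow> nprod n e e = 0"
  and e_nonzero: "e \<noteq> 0"
  using identity nprod_zero_left unfolding conformal_identity_def by auto

lemmas assoc = nprod_assoc[OF associative]

lemma assoc_0: "f \<in> C \<Longrightarrow> g \<in> C \<Longrightarrow> h \<in> C \<Longrightarrow> nprod 0 f (nprod n g h) = nprod n (nprod 0 f g) h"
  by (subst assoc) simp_all

lemma assoc_1: "f \<in> C \<Longrightarrow> g \<in> C \<Longrightarrow> h \<in> C \<Longrightarrow>
    nprod 1 f (nprod n g h) = nprod (Suc n) (nprod 0 f g) h + nprod n (nprod 1 f g) h"
  by (subst assoc) simp_all

text \<open>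
  An element that all higher products with \<open>e\<close> kill behaves in \<open>e \<circ>\<^sub>m (a \<circ>\<^sub>n b)\<close> like a constant: only the
  summand \<open>j = 0\<close> of the associativity law survives.  For \<open>a = e\<close> this says \<open>e \<circ>\<^sub>m = (e \<circ>\<^sub>1)\<^sup>m\<close>.
\<close>

lemma nprod_e_constant_left:
  assumes "a \<in> C" "b \<in> C" and const: "\<And>j. j \<ge> 1 \<Longrightarrow> nprod j e a = 0"
  shows "nprod m e (nprod n a b) = nprod (m + n) a b"
proof -
  have "nprod m e (nprod n a b) =
      (\<Sum>j\<le>m. cs (of_nat (m choose j)) (nprod (m + n - j) (nprod j e a) b))"
    by (rule assoc) (use assms e_C in auto)
  also have "\<dots> = (\<Sum>j\<in>{0}. cs (of_nat (m choose j)) (nprod (m + n - j) (nprod j e a) b))"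
    by (rule sum.mono_neutral_right) (use assms in \<open>auto simp: const nprod_zero_left\<close>)
  finally show ?thesis using assms by (simp add: e_left)
qed

lemma e_iterate: "x \<in> C \<Longrightarrow> nprod m e (nprod n e x) = nprod (m + n) e x"
  by (rule nprod_e_constant_left) (auto simp: e_C e_higher)

text \<open>
  \<open>e \<circ>\<^sub>1\<close> differentiates with respect to \<open>\<partial>\<close>; equivalently \<open>[e \<circ>\<^sub>1, \<partial>] = 1\<close>.
\<close>

lemma e_smul:
  assumes "x \<in> C"
  shows "nprod 1 e (smul P x) = smul P (nprod 1 e x) + smul (pderiv P) x"
proof (induction P)
  case 0
  then show ?case using e_C by (simp add: nprod_zero_right)
next
  case (pCons c P)
  have "nprod 1 e (smul (pCons c P) x) = nprod 1 e (cs c x) + nprod 1 e (\<partial> (smul P x))"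
    unfolding smul_pCons[of c P] using assms e_C by (intro nprod_add_right C_smul)
  also have "\<dots> = cs c (nprod 1 e x) + (\<partial> (nprod 1 e (smul P x)) + smul P x)"
    using assms e_C by (simp add: nprod_scale_right nprod_deriv_right C_smul e_left)
  also have "\<dots> = cs c (nprod 1 e x) + \<partial> (smul P (nprod 1 e x)) + (smul P x + \<partial> (smul (pderiv P) x))"
    unfolding pCons.IH scale_right_distrib by (simp add: algebra_simps)
  also have "\<dots> = smul (pCons c P) (nprod 1 e x) + smul (pderiv (pCons c P)) x"
    unfolding smul_pCons[of c P] pderiv_pCons scale_left_distrib smul_pCons[of 0 "pderiv P"]
    by (simp add: add_ac)
  finally show ?case .
qed

definition constants :: "'c set" where
  "constants = {x \<in> C. nprod 1 e x = 0}"

lemma constants_C: "x \<in> constants \<Longrightarrow> x \<in> C"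
  by (simp add: constants_def)

lemma constants_zero: "0 \<in> constants"
  and constants_add: "x \<in> constants \<Longrightarrow> y \<in> constants \<Longrightarrow> x + y \<in> constants"
  and constants_diff: "x \<in> constants \<Longrightarrow> y \<in> constants \<Longrightarrow> x - y \<in> constants"
  and constants_cs: "x \<in> constants \<Longrightarrow> cs c x \<in> constants"
  and constants_e: "e \<in> constants"
  using e_C e_higher
  by (auto simp: constants_def C_intros nprod_zero_right nprod_add_right nprod_diff_right nprod_scale_right)

lemma constants_higher:
  assumes "x \<in> constants" "n \<ge> 1" shows "nprod n e x = 0"
proof -
  have "nprod n e x = nprod (n - 1) e (nprod 1 e x)"
    using assms by (subst e_iterate) (auto simp: constants_C)
  then show ?thesis using assms e_C by (simp add: constants_def nprod_zero_right)
qed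

lemma e_nprod: "a \<in> constants \<Longrightarrow> b \<in> C \<Longrightarrow> nprod m e (nprod n a b) = nprod (m + n) a b"
  by (rule nprod_e_constant_left) (auto simp: constants_C constants_higher)

lemma deriv_constant_zero:
  assumes y: "y \<in> C" and const: "\<partial> y \<in> constants"
  shows "y = 0"
proof -
  have step: "nprod n e y = 0" if "nprod (Suc n) e y = 0" for n
  proof -
    have "0 = nprod (Suc n) e (\<partial> y)" using constants_higher[OF const] by simp
    also have "\<dots> = cs (of_nat (Suc n)) (nprod n e y)"
      using y e_C that by (simp add: nprod_deriv_right del: of_nat_Suc)
    finally show ?thesis by (simp del: of_nat_Suc)
  qed
  have "nprod N e y = 0 \<Longrightarrow> nprod 0 e y = 0" for N
    by (induction N) (auto dest: step)
  then show ?thesis using locality[OF e_C y] e_left[OF y] by force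
qed

text \<open>
  The constant part of \<open>x\<close> is the Taylor polynomial \<open>\<Sum>\<^sub>k (-1)\<^sup>k \<partial>\<^sup>k (e \<circ>\<^sub>k x) / k!\<close>, the evaluation at
  \<open>\<partial> = 0\<close> of a polynomial in \<open>\<partial>\<close>.  Under \<open>e \<circ>\<^sub>1\<close> the partial sums telescope.
\<close>

lemma constant_part_exists:
  assumes x: "x \<in> C"
  shows "\<exists>c\<in>constants. \<exists>y\<in>C. x = c + \<partial> y"
proof -
  define q :: "nat \<Rightarrow> complex" where "q k = (- 1) ^ k / fact k" for k
  define t where "t k = smul (monom (q k) k) (nprod k e x)" for k
  have tC: "t k \<in> C" for k using x e_C by (simp add: t_def C_intros)
  have q_Suc: "of_nat (Suc k) * q (Suc k) = - q k" for k
    by (simp add: q_def field_simps del: of_nat_Suc)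
  have dt: "nprod 1 e (t k) = smul (monom (q k) k) (nprod (Suc k) e x) +
      smul (monom (of_nat k * q k) (k - 1)) (nprod k e x)" for k
    using x e_C unfolding t_def by (subst e_smul) (auto simp: nprod_closed pderiv_monom e_iterate)
  have telescope: "nprod 1 e (\<Sum>k<Suc N. t k) = smul (monom (q N) N) (nprod (Suc N) e x)" for N
  proof (induction N)
    case 0
    then show ?case using dt[of 0] by simp
  next
    case (Suc N)
    have "nprod 1 e (\<Sum>k<Suc (Suc N). t k) = nprod 1 e (\<Sum>k<Suc N. t k) + nprod 1 e (t (Suc N))"
      unfolding sum.lessThan_Suc[of t "Suc N"] using e_C tC by (intro nprod_add_right C_sum)
    also have "\<dots> = smul (monom (q N) N) (nprod (Suc N) e x) + (smul (monom (q (Suc N)) (Suc N)) (nprod (Suc (Suc N)) e x) +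
      smul (monom (- q N) N) (nprod (Suc N) e x))"
      unfolding Suc.IH dt q_Suc by simp
    also have "\<dots> = smul (monom (q (Suc N)) (Suc N)) (nprod (Suc (Suc N)) e x)"
      by (simp flip: minus_monom)
    finally show ?case .
  qed
  obtain N where N: "\<forall>n\<ge>N. nprod n e x = 0" using locality[OF e_C x] by blast
  define y where "y = (\<Sum>k<N. smul (monom (q (Suc k)) k) (nprod (Suc k) e x))"
  have yC: "y \<in> C" using x e_C by (auto simp: y_def intro!: C_intros)
  have "(\<Sum>k<Suc N. t k) = t 0 + (\<Sum>k<N. t (Suc k))"
    by (simp add: sum.lessThan_Suc_shift del: sum.lessThan_Suc)
  also have "(\<Sum>k<N. t (Suc k)) = \<partial> y"
    unfolding y_def t_def scale_sum_right monom_Suc smul_pCons[of 0 "monom _ _"] by simp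
  also have "t 0 = x" by (simp add: t_def q_def e_left x monom_0)
  finally have "x = (\<Sum>k<Suc N. t k) + \<partial> (- y)" by simp
  moreover have "(\<Sum>k<Suc N. t k) \<in> constants"
    using telescope[of N] N C_sum[of "{..<Suc N}" t] tC by (simp add: constants_def)
  moreover have "- y \<in> C" using C_diff[OF C_zero yC] by simp
  ultimately show ?thesis by blast
qed

lemma constant_part_unique:
  assumes "c \<in> constants" "c' \<in> constants" "y \<in> C" "y' \<in> C" "c + \<partial> y = c' + \<partial> y'"
  shows "c = c'"
proof -
  have eq: "\<partial> (y - y') = c' - c" using assms(5) by (simp add: scale_right_diff_distrib algebra_simps)
  have "y - y' = 0"
    by (rule deriv_constant_zero) (use assms in \<open>auto simp: eq C_diff constants_diff\<close>)
  then show ?thesis using assms(5) by simp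
qed

text \<open>
  The projection of \<open>C\<close> onto the constants along \<open>\<partial>C\<close>.
\<close>

definition \<rho> :: "'c \<Rightarrow> 'c" where
  "\<rho> x = (THE c. c \<in> constants \<and> (\<exists>y\<in>C. x = c + \<partial> y))"

lemma rho_eq: "c \<in> constants \<Longrightarrow> y \<in> C \<Longrightarrow> \<rho> (c + \<partial> y) = c"
  unfolding \<rho>_def by (rule the_equality) (auto dest: constant_part_unique)

lemma rho_decomposition:
  assumes "x \<in> C"
  obtains y where "y \<in> C" "x = \<rho> x + \<partial> y"
  using constant_part_exists[OF assms] rho_eq by metis

lemma rho_constants: "x \<in> C \<Longrightarrow> \<rho> x \<in> constants"
  using constant_part_exists rho_eq by metis

lemma rho_C: "x \<in> C \<Longrightarrow> \<rho> x \<in> C"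
  by (simp add: rho_constants constants_C)

lemma rho_id: "c \<in> constants \<Longrightarrow> \<rho> c = c"
  using rho_eq[of c 0] by (simp add: C_zero)

lemma rho_deriv: "x \<in> C \<Longrightarrow> \<rho> (\<partial> x) = 0"
  using rho_eq[of 0 x] by (simp add: constants_zero)

lemma rho_add:
  assumes "x \<in> C" "y \<in> C" shows "\<rho> (x + y) = \<rho> x + \<rho> y"
proof -
  obtain x' where x': "x' \<in> C" "x = \<rho> x + \<partial> x'" using assms(1) by (rule rho_decomposition)
  obtain y' where y': "y' \<in> C" "y = \<rho> y + \<partial> y'" using assms(2) by (rule rho_decomposition)
  have "(\<rho> x + \<partial> x') + (\<rho> y + \<partial> y') = (\<rho> x + \<rho> y) + \<partial> (x' + y')"
    by (simp add: scale_right_distrib add_ac)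
  then have eq: "x + y = (\<rho> x + \<rho> y) + \<partial> (x' + y')"
    unfolding x'(2)[symmetric] y'(2)[symmetric] .
  show ?thesis
    unfolding eq using assms x'(1) y'(1)
    by (intro rho_eq) (simp_all add: constants_add rho_constants C_add)
qed

lemma rho_cs:
  assumes "x \<in> C" shows "\<rho> (cs c x) = cs c (\<rho> x)"
proof -
  obtain x' where x': "x' \<in> C" "x = \<rho> x + \<partial> x'" using assms(1) by (rule rho_decomposition)
  have "cs c (\<rho> x + \<partial> x') = cs c (\<rho> x) + \<partial> (cs c x')"
    unfolding deriv_cs by (rule scale_right_distrib)
  then have eq: "cs c x = cs c (\<rho> x) + \<partial> (cs c x')"
    unfolding x'(2)[symmetric] .
  show ?thesis
    unfolding eq using assms x'(1)
    by (intro rho_eq) (simp_all only: constants_cs rho_constants C_smul)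
qed

lemma nprod_e_deriv:
  "x \<in> C \<Longrightarrow> nprod n e (\<partial> x) = \<partial> (nprod n e x) + cs (of_nat n) (nprod (n - 1) e x)"
  using e_C by (rule nprod_deriv_right)

lemma nprod_e_peel:
  assumes "y \<in> C" "x = c + \<partial> y" "c \<in> constants"
  shows "nprod (Suc n) e x = \<partial> (nprod (Suc n) e y) + cs (of_nat (Suc n)) (nprod n e y)"
  using assms(1,3) e_C unfolding assms(2)
  by (simp add: nprod_add_right constants_C C_smul constants_higher nprod_e_deriv)

text \<open>
  Induction along \<open>x = \<rho> x + \<partial> y\<close>.  It terminates because \<open>y\<close> is killed by one power of \<open>e \<circ>\<^sub>1\<close> less than
  \<open>x\<close>.  The set \<open>J\<close>, closed under passing from \<open>x\<close> to \<open>y\<close>, is \<open>C\<close> or an ideal.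
\<close>

lemma component_induct [consumes 2, case_names peel zero step]:
  assumes "x \<in> J" "J \<subseteq> C"
    and peel: "\<And>x y. x \<in> J \<Longrightarrow> y \<in> C \<Longrightarrow> x = \<rho> x + \<partial> y \<Longrightarrow> y \<in> J"
    and zero: "P 0"
    and step: "\<And>x y. x \<in> J \<Longrightarrow> y \<in> J \<Longrightarrow> x = \<rho> x + \<partial> y \<Longrightarrow> P y \<Longrightarrow> P x"
  shows "P x"
proof -
  have "P x" if "x \<in> J" "\<forall>n\<ge>N. nprod n e x = 0" for N x
    using that
  proof (induction N arbitrary: x)
    case 0
    then have "x = 0" using e_left[of x] assms(2) by auto
    then show ?case using zero by simp
  next
    case (Suc N)
    then have xC: "x \<in> C" using assms(2) by blast
    obtain y where y: "y \<in> C" "x = \<rho> x + \<partial> y" using xC by (rule rho_decomposition)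
    \<comment> \<open>applying \<open>e \<circ>\<^bsub>n+1\<^esub>\<close> to \<open>x = \<rho> x + \<partial> y\<close> expresses \<open>e \<circ>\<^sub>n y\<close> through \<open>e \<circ>\<^bsub>n+1\<^esub> y\<close>, so vanishing descends from large \<open>n\<close>\<close>
    have down: "nprod n e y = 0" if n: "n \<ge> N" and z: "nprod (Suc n) e y = 0" for n
    proof -
      have "0 = nprod (Suc n) e x" using Suc.prems(2) n by (metis Suc_le_mono)
      also have "\<dots> = cs (of_nat (Suc n)) (nprod n e y)"
        using nprod_e_peel[OF y rho_constants[OF xC], of n] z by simp
      finally show ?thesis by (simp del: of_nat_Suc)
    qed
    have down_many: "nprod (n + k) e y = 0 \<Longrightarrow> nprod n e y = 0" if "n \<ge> N" for n k
      using that by (induction k) (auto dest: down[rotated])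
    obtain M where "\<forall>n\<ge>M. nprod n e y = 0" using locality[OF e_C y(1)] by blast
    then have "\<forall>n\<ge>N. nprod n e y = 0" using down_many[of _ M] by simp
    moreover have "y \<in> J" using peel Suc.prems(1) y by blast
    ultimately have "P y" using Suc.IH by blast
    then show ?case using step Suc.prems(1) \<open>y \<in> J\<close> y(2) by blast
  qed
  then show ?thesis using locality[OF e_C, of x] assms by blast
qed

lemma C_induct [consumes 1, case_names base plus derivative]:
  assumes "x \<in> C"
    and "\<And>c. c \<in> constants \<Longrightarrow> P c"
    and "\<And>x y. x \<in> C \<Longrightarrow> y \<in> C \<Longrightarrow> P x \<Longrightarrow> P y \<Longrightarrow> P (x + y)"
    and "\<And>x. x \<in> C \<Longrightarrow> P x \<Longrightarrow> P (\<partial> x)"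
  shows "P x"
  using assms(1) order_refl
proof (induction x rule: component_induct)
  case zero
  show ?case using assms(2) constants_zero by blast
next
  case (step x y)
  have "P (\<rho> x + \<partial> y)"
    using step(1,2,4) assms(2,4) by (intro assms(3)) (auto simp: rho_constants rho_C C_smul)
  then show ?case unfolding step(3)[symmetric] .
qed

text \<open>
  With \<open>C/\<partial>C\<close> identified with the constants, \<open>star\<close> is the product that \<open>\<circ>\<^sub>0\<close> induces on the quotient.
\<close>

definition star :: "'c \<Rightarrow> 'c \<Rightarrow> 'c" where
  "star a b = \<rho> (nprod 0 a b)"

text \<open>
  The derivation of the constants given by the commutator with \<open>e \<circ>\<^sub>1\<close>, see \<open>delta_act\<close>.
\<close>

definition \<delta> :: "'c \<Rightarrow> 'c" where
  "\<delta> a = \<rho> (nprod 1 a e)"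

lemma nprod_0_deriv_left: "x \<in> C \<Longrightarrow> z \<in> C \<Longrightarrow> nprod 0 (\<partial> x) z = 0"
  by (simp add: nprod_deriv_left)

lemma nprod_0_deriv_right: "x \<in> C \<Longrightarrow> z \<in> C \<Longrightarrow> nprod 0 x (\<partial> z) = \<partial> (nprod 0 x z)"
  by (simp add: nprod_deriv_right)

lemma nprod_0_rho:
  assumes "x \<in> C" "z \<in> C"
  shows "nprod 0 (\<rho> x) z = nprod 0 x z"
proof -
  obtain y where y: "y \<in> C" "x = \<rho> x + \<partial> y" using assms(1) by (rule rho_decomposition)
  have "nprod 0 x z = nprod 0 (\<rho> x + \<partial> y) z"
    by (rule arg_cong[where f = "\<lambda>u. nprod 0 u z", OF y(2)])
  also have "\<dots> = nprod 0 (\<rho> x) z"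
    using assms y(1) by (simp add: nprod_add_left rho_C C_smul nprod_0_deriv_left)
  finally show ?thesis by simp
qed

lemma star_closed: "a \<in> C \<Longrightarrow> b \<in> C \<Longrightarrow> star a b \<in> constants"
  and delta_closed: "a \<in> C \<Longrightarrow> \<delta> a \<in> constants"
  using e_C by (auto simp: star_def \<delta>_def rho_constants nprod_closed)

lemma star_act: "a \<in> C \<Longrightarrow> b \<in> C \<Longrightarrow> z \<in> C \<Longrightarrow> nprod 0 (star a b) z = nprod 0 a (nprod 0 b z)"
  by (simp add: star_def nprod_0_rho nprod_closed assoc_0)

text \<open>
  For constant \<open>a\<close> the left side is \<open>a \<circ>\<^sub>1 z\<close>.  Expanding \<open>a \<circ>\<^sub>1 (e \<circ>\<^sub>0 z)\<close> by associativity compares it with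
  \<open>a \<circ>\<^sub>0 (e \<circ>\<^sub>1 z)\<close>.
\<close>

lemma delta_act: "a \<in> constants \<Longrightarrow> z \<in> C \<Longrightarrow>
    nprod 1 e (nprod 0 a z) = nprod 0 a (nprod 1 e z) + nprod 0 (\<delta> a) z"
  using assoc_1[of a e z 0] e_nprod[of a z 1 0] assoc_0[of a e z 1] e_C
  by (simp add: \<delta>_def nprod_0_rho nprod_closed constants_C e_left)

lemma rho_act:
  assumes "a \<in> C" "x \<in> C" shows "\<rho> (nprod 0 a x) = star a (\<rho> x)"
proof -
  obtain y where y: "y \<in> C" "x = \<rho> x + \<partial> y" using assms(2) by (rule rho_decomposition)
  have "\<rho> (nprod 0 a x) = \<rho> (nprod 0 a (\<rho> x + \<partial> y))"
    by (rule arg_cong[where f = "\<lambda>u. \<rho> (nprod 0 a u)", OF y(2)])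
  also have "\<dots> = star a (\<rho> x)"
    using assms y(1)
    by (simp add: star_def nprod_add_right rho_C C_smul nprod_closed nprod_0_deriv_right rho_add rho_deriv)
  finally show ?thesis .
qed

text \<open>
  The associativity law can be solved for its summand \<open>j = m\<close>, which is \<open>(f \<circ>\<^sub>m g) \<circ>\<^sub>n h\<close>.  This is what makes
  the left annihilator of \<open>C\<close> a two-sided ideal.
\<close>

lemma nprod_nprod_zero:
  assumes "f \<in> C" "g \<in> C"
    and zero: "\<And>p q h. h \<in> C \<Longrightarrow> nprod p f (nprod q g h) = 0"
  shows "h \<in> C \<Longrightarrow> nprod n (nprod m f g) h = 0"
proof (induction m arbitrary: n h rule: less_induct)
  case (less m)
  have "0 = nprod m f (nprod n g h)" using zero less.prems by simp
  also have "\<dots> = (\<Sum>j\<le>m. cs (of_nat (m choose j)) (nprod (m + n - j) (nprod j f g) h))"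
    using assms less.prems by (intro assoc)
  also have "\<dots> = (\<Sum>j\<in>{m}. cs (of_nat (m choose j)) (nprod (m + n - j) (nprod j f g) h))"
    using less by (intro sum.mono_neutral_right) auto
  finally show ?case by (simp)
qed

end

section \<open>The differential algebra of constants\<close>

locale finite_simple_unital_associative = unital_associative smul C nprod e
  for smul :: "complex poly \<Rightarrow> 'c::ab_group_add \<Rightarrow> 'c" and C nprod e +
  assumes simple: simple_conformal and fin_gen: finitely_generated
begin

lemma faithful:
  assumes x: "x \<in> C" and zero: "\<And>n z. z \<in> C \<Longrightarrow> nprod n x z = 0"
  shows "x = 0"
proof -
  define J where "J = {f \<in> C. \<forall>n. \<forall>g\<in>C. nprod n f g = 0}"
  have JC: "f \<in> J \<Longrightarrow> f \<in> C" and J0: "f \<in> J \<Longrightarrow> g \<in> C \<Longrightarrow> nprod n f g = 0" for f g n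
    by (auto simp: J_def)
  have "subspace J"
    by (rule subspace_from_generators)
      (auto simp: J_def C_intros nprod_zero_left nprod_add_left nprod_scale_left nprod_deriv_left)
  moreover have "nprod n f x \<in> J" "nprod n x f \<in> J" if "f \<in> C" "x \<in> J" for n f x
    using that by (auto simp: J_def nprod_closed nprod_zero_left nprod_zero_right C_zero intro!: nprod_nprod_zero)
  ultimately have "conformal_ideal J"
    unfolding conformal_ideal_def conformal_subalgebra_def using JC by blast
  then have "J = {0} \<or> J = C" using simple unfolding simple_conformal_def by blast
  moreover have "e \<notin> J" using J0[of e e 0] e_C e_left e_nonzero by auto
  moreover have "x \<in> J" using x zero by (simp add: J_def)
  ultimately show ?thesis using e_C by blast
qed

text \<open>
  For constant \<open>a\<close> all products \<open>a \<circ>\<^sub>n z = e \<circ>\<^sub>n (a \<circ>\<^sub>0 z)\<close> are determined by \<open>\<circ>\<^sub>0\<close>.  Identities between constants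
  can therefore be checked on their action by \<open>\<circ>\<^sub>0\<close>, where associativity holds without correction terms.
\<close>

lemma faithful_constants:
  assumes "a \<in> constants" "b \<in> constants" "\<And>z. z \<in> C \<Longrightarrow> nprod 0 a z = nprod 0 b z"
  shows "a = b"
proof -
  have "nprod n a z = nprod n b z" if "z \<in> C" for n z
    using that assms e_nprod[of a z n 0] e_nprod[of b z n 0] by simp
  then have "a - b = 0"
    by (intro faithful[of "a - b"]) (use assms in \<open>auto simp: nprod_diff_left constants_C C_diff\<close>)
  then show ?thesis by simp
qed

lemma rho_smul_span: "x \<in> C \<Longrightarrow> \<exists>c. \<rho> (smul P x) = cs c (\<rho> x)"
proof (induction P)
  case 0
  then show ?case using rho_id[OF constants_zero] by (auto intro: exI[of _ 0])
next
  case (pCons c P)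
  then show ?case
    unfolding smul_pCons[of c P] by (auto simp: rho_add C_smul rho_deriv rho_cs)
qed

lemma constants_finite_dim: "\<exists>S. finite S \<and> constants \<subseteq> sc.span S"
proof -
  obtain S where S: "finite S" "S \<subseteq> C" "span S = C"
    using fin_gen unfolding finitely_generated_def by blast
  let ?T = "{x \<in> C. \<rho> x \<in> sc.span (\<rho> ` S)}"
  have "subspace ?T"
    unfolding subspace_def
  proof (intro conjI ballI allI)
    show "0 \<in> ?T" using C_zero rho_id[OF constants_zero] by (simp add: sc.span_zero)
    show "x + y \<in> ?T" if "x \<in> ?T" "y \<in> ?T" for x y
      using that by (simp add: C_add rho_add sc.span_add)
    show "smul P x \<in> ?T" if x: "x \<in> ?T" for P x
    proof -
      obtain c where "\<rho> (smul P x) = cs c (\<rho> x)" using rho_smul_span x by blast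
      then show ?thesis using x by (simp add: C_smul sc.span_scale)
    qed
  qed
  moreover have "S \<subseteq> ?T" using S(2) by (auto intro: sc.span_base)
  ultimately have "C \<subseteq> ?T" using S(3) span_minimal by blast
  then have "constants \<subseteq> sc.span (\<rho> ` S)" using rho_id constants_C by fastforce
  then show ?thesis using S(1) by blast
qed

lemma delta_pow:
  assumes "a \<in> constants"
  shows "(\<delta> ^^ n) a \<in> constants \<and> nprod n e (nprod 0 a e) = nprod 0 ((\<delta> ^^ n) a) e"
proof (induction n)
  case 0
  then show ?case using assms e_C by (simp add: e_left nprod_closed constants_C)
next
  case (Suc n)
  let ?b = "(\<delta> ^^ n) a"
  have b: "?b \<in> constants" using Suc by blast
  have "nprod (Suc n) e (nprod 0 a e) = nprod 1 e (nprod n e (nprod 0 a e))"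
    using assms e_C by (simp add: e_iterate nprod_closed constants_C)
  also have "\<dots> = nprod 1 e (nprod 0 ?b e)" using Suc by simp
  also have "\<dots> = nprod 0 (\<delta> ?b) e"
    using delta_act[OF b e_C] b e_C e_higher by (simp add: nprod_zero_right constants_C)
  finally show ?case using b by (simp add: delta_closed constants_C)
qed

lemma star_e:
  assumes "a \<in> constants" shows "star a e = a" "star e a = a"
proof -
  show "star a e = a"
    by (rule faithful_constants) (use assms e_C in \<open>auto simp: star_closed star_act constants_C e_left\<close>)
  show "star e a = a"
    using assms by (simp add: star_def e_left constants_C rho_id)
qed

text \<open>
  The submodule \<open>\<complex>[\<partial>] I\<close>: up to factorials, the \<open>\<rho> (e \<circ>\<^sub>n x)\<close> are the coefficients of \<open>x\<close> as a polynomial in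
  \<open>\<partial>\<close> over the constants.
\<close>

definition extension :: "'c set \<Rightarrow> 'c set" where
  "extension I = {x \<in> C. \<forall>n. \<rho> (nprod n e x) \<in> I}"

lemma extension_ideal:
  assumes I: "sc.subspace I" "I \<subseteq> constants"
    and star: "\<And>a x. a \<in> constants \<Longrightarrow> x \<in> I \<Longrightarrow> star a x \<in> I \<and> star x a \<in> I"
    and der: "\<And>x. x \<in> I \<Longrightarrow> \<delta> x \<in> I"
  shows "conformal_ideal (extension I)"
proof -
  let ?J = "extension I"
  have I0: "0 \<in> I" and Iadd: "\<And>x y. x \<in> I \<Longrightarrow> y \<in> I \<Longrightarrow> x + y \<in> I"
    and Ics: "\<And>c x. x \<in> I \<Longrightarrow> cs c x \<in> I"
    using I(1) by (auto simp: sc.subspace_def)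
  have JC: "x \<in> ?J \<Longrightarrow> x \<in> C" and Jn: "x \<in> ?J \<Longrightarrow> \<rho> (nprod n e x) \<in> I" for x n
    by (auto simp: extension_def)
  have sub: "subspace ?J"
  proof (rule subspace_from_generators)
    show "0 \<in> ?J" using e_C I0 by (simp add: extension_def C_zero nprod_zero_right rho_id constants_zero)
    show "x + y \<in> ?J" if "x \<in> ?J" "y \<in> ?J" for x y
      using that e_C by (simp add: extension_def C_intros nprod_add_right rho_add Iadd)
    show "cs c x \<in> ?J" if "x \<in> ?J" for c x
      using that e_C by (simp add: extension_def C_intros nprod_scale_right rho_cs Ics)
    show "\<partial> x \<in> ?J" if "x \<in> ?J" for x
      using that e_C
      by (simp add: extension_def C_intros nprod_e_deriv rho_add rho_cs rho_deriv Ics)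
  qed
  note Jadd = subspace_add[OF sub] and Jsmul = subspace_scale[OF sub]
  have Je: "nprod n e x \<in> ?J" if "x \<in> ?J" for n x
    using that e_C by (auto simp: extension_def nprod_closed e_iterate)
  have rhoI: "\<rho> x \<in> I" if "x \<in> ?J" for x
    using Jn[OF that, of 0] JC[OF that] by (simp add: e_left)
  have peel: "y \<in> ?J" if x: "x \<in> ?J" and y: "y \<in> C" "x = \<rho> x + \<partial> y" for x y
  proof -
    have "\<rho> (nprod n e y) \<in> I" for n
    proof -
      have "\<rho> (nprod (Suc n) e x) = cs (of_nat (Suc n)) (\<rho> (nprod n e y))"
        unfolding nprod_e_peel[OF y rho_constants[OF JC[OF x]]]
        using y(1) e_C by (simp add: rho_add rho_deriv rho_cs C_smul nprod_closed del: of_nat_Suc)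
      then have "cs (of_nat (Suc n)) (\<rho> (nprod n e y)) \<in> I"
        using Jn[OF x, of "Suc n"] by simp
      from Ics[OF this, of "1 / of_nat (Suc n)"] show ?thesis by (simp del: of_nat_Suc)
    qed
    then show ?thesis using y(1) by (simp add: extension_def)
  qed
  \<comment> \<open>by \<open>delta_act\<close>, moving \<open>e \<circ>\<^sub>1\<close> past \<open>a \<circ>\<^sub>0\<close> costs a derivative of \<open>a\<close>; \<open>I\<close> being stable under \<open>\<delta>\<close> matters for \<open>a \<in> I\<close>\<close>
  have act: "\<rho> (nprod n e (nprod 0 a x)) \<in> I"
    if "a \<in> constants \<and> x \<in> ?J \<or> a \<in> I \<and> x \<in> C" for n a x
    using that
  proof (induction n arbitrary: a x)
    case 0
    then have "a \<in> constants" "x \<in> C" using JC I(2) by auto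
    then show ?case
      using 0 star[of a "\<rho> x"] star[of "\<rho> x" a] rhoI
      by (auto simp: e_left nprod_closed constants_C rho_act rho_constants)
  next
    case (Suc n)
    then have a: "a \<in> constants" and x: "x \<in> C" using JC I(2) by auto
    have "nprod (Suc n) e (nprod 0 a x) = nprod n e (nprod 1 e (nprod 0 a x))"
      using a x e_C by (simp add: e_iterate nprod_closed constants_C)
    also have "\<dots> = nprod n e (nprod 0 a (nprod 1 e x)) + nprod n e (nprod 0 (\<delta> a) x)"
      unfolding delta_act[OF a x]
      using a x e_C by (simp add: nprod_add_right nprod_closed constants_C delta_closed)
    finally have eq: "\<rho> (nprod (Suc n) e (nprod 0 a x)) =
        \<rho> (nprod n e (nprod 0 a (nprod 1 e x))) + \<rho> (nprod n e (nprod 0 (\<delta> a) x))"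
      using a x e_C by (simp add: rho_add nprod_closed constants_C delta_closed)
    have "\<rho> (nprod n e (nprod 0 a (nprod 1 e x))) \<in> I"
      using Suc.prems Je[of x 1] x e_C by (intro Suc.IH) (auto simp: nprod_closed)
    moreover have "\<rho> (nprod n e (nprod 0 (\<delta> a) x)) \<in> I"
      using Suc.prems der[of a] a by (intro Suc.IH) (auto simp: delta_closed constants_C)
    ultimately show ?case unfolding eq by (rule Iadd)
  qed
  have act_J: "nprod 0 a x \<in> ?J"
    if "a \<in> constants \<and> x \<in> ?J \<or> a \<in> I \<and> x \<in> C" for a x
  proof -
    have "a \<in> C" "x \<in> C" using that JC I(2) constants_C by blast+
    then show ?thesis using act[OF that] by (simp add: extension_def nprod_closed)
  qed
  have left: "\<forall>m. \<forall>x\<in>?J. nprod m f x \<in> ?J" if "f \<in> C" for f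
    using that
  proof (induction f rule: C_induct)
    case (base a)
    show ?case
    proof (intro allI ballI)
      fix m x assume x: "x \<in> ?J"
      have "nprod m e (nprod 0 a x) \<in> ?J" using base x by (intro Je act_J) blast
      then show "nprod m a x \<in> ?J" using e_nprod[OF base JC[OF x], of m 0] by simp
    qed
  next
    case (plus f g)
    then show ?case by (simp add: JC nprod_add_left Jadd)
  next
    case (derivative f)
    then show ?case by (simp add: JC nprod_deriv_left Jsmul subspace_neg[OF sub])
  qed
  have J_subset: "?J \<subseteq> C" using JC by blast
  have right: "\<forall>m. \<forall>f\<in>C. nprod m x f \<in> ?J" if "x \<in> ?J" for x
    using that J_subset
  proof (induction x rule: component_induct)
    case (peel x y)
    then show ?case using \<open>\<And>x y. x \<in> ?J \<Longrightarrow> y \<in> C \<Longrightarrow> x = \<rho> x + \<partial> y \<Longrightarrow> y \<in> ?J\<close> by blast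
  next
    case zero
    show ?case using sub by (simp add: nprod_zero_left subspace_0)
  next
    case (step x y)
    have yC: "y \<in> C" and xC: "x \<in> C" using step JC by auto
    show ?case
    proof (intro allI ballI)
      fix m f assume f: "f \<in> C"
      have "nprod m (\<rho> x + \<partial> y) f = nprod m (\<rho> x) f + nprod m (\<partial> y) f"
        using f xC yC by (simp add: nprod_add_left rho_C C_smul)
      then have "nprod m x f = nprod m (\<rho> x) f + nprod m (\<partial> y) f"
        unfolding step(3)[symmetric] .
      also have "nprod m (\<rho> x) f = nprod m e (nprod 0 (\<rho> x) f)"
        using e_nprod[of "\<rho> x" f m 0] xC f by (simp add: rho_constants)
      finally have "nprod m x f = nprod m e (nprod 0 (\<rho> x) f) + cs (- of_nat m) (nprod (m - 1) y f)"
        using yC f by (simp add: nprod_deriv_left)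
      moreover have "nprod m e (nprod 0 (\<rho> x) f) \<in> ?J"
        using rhoI[OF step(1)] f by (intro Je act_J) blast
      moreover have "cs (- of_nat m) (nprod (m - 1) y f) \<in> ?J"
        using step(4) f by (intro Jsmul) blast
      ultimately show "nprod m x f \<in> ?J" by (simp only: Jadd)
    qed
  qed
  show ?thesis
    unfolding conformal_ideal_def conformal_subalgebra_def
    using sub JC left right by blast
qed

lemma differential_algebra_constants: "differential_algebra cs constants star e \<delta>"
proof
  show "sc.subspace constants"
    by (simp add: sc.subspace_def constants_zero constants_add constants_cs)
  fix a b assume a: "a \<in> constants" and b: "b \<in> constants"
  note C = constants_C[OF a] constants_C[OF b] e_C
  show "star a b \<in> constants" using C by (simp add: star_closed)
  show "star (cs c a) b = cs c (star a b)" "star a (cs c b) = cs c (star a b)" for c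
    using C by (simp_all add: star_def nprod_scale_left nprod_scale_right rho_cs nprod_closed)
  show "\<delta> (star a b) = star (\<delta> a) b + star a (\<delta> b)"
  proof (rule faithful_constants)
    fix z assume z: "z \<in> C"
    have sC: "star a b \<in> constants" "\<delta> a \<in> constants" "\<delta> b \<in> constants"
      using C by (auto simp: star_closed delta_closed)
    note sC' = sC[THEN constants_C]
    have "nprod 0 (star a b) (nprod 1 e z) + nprod 0 (\<delta> (star a b)) z =
        nprod 1 e (nprod 0 a (nprod 0 b z))"
      using delta_act[OF sC(1) z] C z by (simp add: star_act)
    also have "\<dots> = nprod 0 a (nprod 1 e (nprod 0 b z)) + nprod 0 (\<delta> a) (nprod 0 b z)"
      using C z by (intro delta_act a nprod_closed)
    also have "nprod 1 e (nprod 0 b z) = nprod 0 b (nprod 1 e z) + nprod 0 (\<delta> b) z"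
      using b z by (rule delta_act)
    also have "nprod 0 a (nprod 0 b (nprod 1 e z) + nprod 0 (\<delta> b) z) =
        nprod 0 (star a b) (nprod 1 e z) + nprod 0 (star a (\<delta> b)) z"
      using C sC' z by (simp add: nprod_add_right nprod_closed star_act)
    also have "nprod 0 (\<delta> a) (nprod 0 b z) = nprod 0 (star (\<delta> a) b) z"
      using C sC' z by (simp add: star_act)
    finally show "nprod 0 (\<delta> (star a b)) z = nprod 0 (star (\<delta> a) b + star a (\<delta> b)) z"
      using C sC' z by (simp add: nprod_add_left star_closed constants_C)
  qed (use C in \<open>auto simp: star_closed delta_closed constants_C constants_add\<close>)
next
  fix a a' b assume "a \<in> constants" "a' \<in> constants" "b \<in> constants"
  note C = this[THEN constants_C]
  show "star (a + a') b = star a b + star a' b"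
    using C by (simp add: star_def nprod_add_left rho_add nprod_closed)
next
  fix a b b' assume "a \<in> constants" "b \<in> constants" "b' \<in> constants"
  note C = this[THEN constants_C]
  show "star a (b + b') = star a b + star a b'"
    using C by (simp add: star_def nprod_add_right rho_add nprod_closed)
  show "star (star a b) b' = star a (star b b')"
    by (rule faithful_constants) (use C in \<open>simp_all add: star_closed star_act nprod_closed constants_C\<close>)
next
  show "e \<in> constants" by (rule constants_e)
  show "e \<noteq> 0" by (rule e_nonzero)
  show "\<exists>S. finite S \<and> constants \<subseteq> sc.span S" by (rule constants_finite_dim)
next
  fix a assume a: "a \<in> constants"
  note C = constants_C[OF a] e_C
  show "star e a = a" "star a e = a" using star_e a by auto
  show "\<delta> a \<in> constants" using C by (simp add: delta_closed)
  show "\<delta> (cs c a) = cs c (\<delta> a)" for c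
    using C by (simp add: \<delta>_def nprod_scale_left rho_cs nprod_closed)
  show "\<exists>N. (\<delta> ^^ N) a = 0"
  proof -
    obtain N where N: "nprod N e (nprod 0 a e) = 0"
      using locality[OF e_C nprod_closed[OF C]] by blast
    then have "star ((\<delta> ^^ N) a) e = 0"
      using delta_pow[OF a, of N] rho_id[OF constants_zero] by (simp add: star_def)
    then show ?thesis using star_e delta_pow[OF a, of N] by auto
  qed
next
  fix a b assume "a \<in> constants" "b \<in> constants"
  note C = this[THEN constants_C] e_C
  show "\<delta> (a + b) = \<delta> a + \<delta> b"
    using C by (simp add: \<delta>_def nprod_add_left rho_add nprod_closed)
next
  fix I assume I: "sc.subspace I" "I \<subseteq> constants"
    and star: "\<And>a x. a \<in> constants \<Longrightarrow> x \<in> I \<Longrightarrow> star a x \<in> I \<and> star x a \<in> I"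
    and der: "\<And>x. x \<in> I \<Longrightarrow> \<delta> x \<in> I"
  have "conformal_ideal (extension I)" using extension_ideal I star der by blast
  then have cases: "extension I = {0} \<or> extension I = C"
    using simple unfolding simple_conformal_def by blast
  have I0: "0 \<in> I" using I(1) by (rule sc.subspace_0)
  have mem: "x \<in> extension I \<longleftrightarrow> x \<in> I" if x: "x \<in> constants" for x
  proof -
    have "\<rho> (nprod n e x) = (if n = 0 then x else 0)" for n
      using x by (simp add: constants_C e_left constants_higher rho_id constants_zero)
    then show ?thesis using x I0 by (auto simp: extension_def constants_C)
  qed
  from cases show "I = {0} \<or> I = constants"
  proof
    assume "extension I = {0}"
    then show ?thesis using mem I I0 by blast
  next
    assume "extension I = C"
    then show ?thesis using mem I constants_C by blast
  qed
qed

end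

section \<open>Changing the identity\<close>

context conformal_algebra
begin

lemma nprod_0_smul_left:
  assumes "x \<in> C" "z \<in> C"
  shows "nprod 0 (smul P x) z = cs (coeff P 0) (nprod 0 x z)"
proof (cases P)
  case (pCons c Q)
  then show ?thesis
    unfolding pCons smul_pCons[of c Q]
    using assms by (simp add: nprod_add_left nprod_scale_left nprod_deriv_left C_smul)
qed

lemma nprod_1_smul_left:
  assumes "x \<in> C" "z \<in> C"
  shows "nprod 1 (smul P x) z = cs (coeff P 0) (nprod 1 x z) - cs (coeff P 1) (nprod 0 x z)"
proof (cases P)
  case (pCons c Q)
  have "nprod 1 (smul (pCons c Q) x) z = cs c (nprod 1 x z) + cs (- 1) (nprod 0 (smul Q x) z)"
    unfolding smul_pCons[of c Q]
    using assms nprod_deriv_left[of "smul Q x" z 1]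
    by (simp add: nprod_add_left nprod_scale_left C_smul)
  then show ?thesis
    unfolding pCons using assms by (simp add: nprod_0_smul_left)
qed

lemma nprod_0_smul_right:
  assumes "x \<in> C" "z \<in> C"
  shows "nprod 0 z (smul P x) = smul P (nprod 0 z x)"
proof (induction P)
  case 0
  then show ?case using assms by (simp add: nprod_zero_right)
next
  case (pCons c P)
  show ?case
    unfolding smul_pCons[of c P]
    using assms by (simp add: nprod_add_right nprod_scale_right nprod_deriv_right C_smul pCons)
qed

end

context finite_simple_unital_associative
begin

text \<open>
  Since \<open>(\<partial>\<^sup>k d\<^sup>k) \<circ>\<^sub>0 = 0\<close> for \<open>k > 0\<close> and \<open>(\<partial>\<^sup>k d\<^sup>k) \<circ>\<^sub>1 = 0\<close> for \<open>k > 1\<close>, the element \<open>e' = \<Sum>\<^sub>k \<partial>\<^sup>k d\<^sup>k / k!\<close> has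
  \<open>e' \<circ>\<^sub>0 = id\<close> and \<open>e' \<circ>\<^sub>1 = e \<circ>\<^sub>1 - d \<circ>\<^sub>0\<close>.  Being an exponential, \<open>e'\<close> is killed by the latter.  Thus
  \<open>e' \<circ>\<^sub>1 e' = 0\<close>, and associativity propagates this to all higher products.  The commutator of
  \<open>e' \<circ>\<^sub>1\<close> with \<open>a \<circ>\<^sub>0\<close> is the action of \<open>\<delta> a - [d, a] = 0\<close>.
\<close>

lemma adapted_identity_exists:
  "\<exists>e'. finite_simple_unital_associative smul C nprod e' \<and>
     (\<forall>f\<in>C. \<forall>z\<in>C. nprod 1 e' (nprod 0 f z) = nprod 0 f (nprod 1 e' z))"
proof -
  interpret A: differential_algebra cs constants star e \<delta>
    by (rule differential_algebra_constants)
  obtain d N where d: "d \<in> constants" and inner: "\<And>a. a \<in> constants \<Longrightarrow> \<delta> a = star d a - star a d"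
    and nil: "(star d ^^ N) e = 0"
    by (rule A.derivation_inner_nilpotent) blast
  note dC = constants_C[OF d]
  define p where "p k = (star d ^^ k) e" for k
  have p: "p k \<in> constants" for k
    by (induction k) (auto simp: p_def constants_e star_closed dC constants_C)
  note pC = constants_C[OF p]
  have p_zero: "p (k + N) = 0" for k
    by (induction k) (auto simp: p_def nil A.mul_zero d)
  have p_0: "p 0 = e" and p_1: "p 1 = d"
    using star_e(1)[OF d] by (auto simp: p_def)
  have "\<delta> d = 0" using inner[OF d] by simp
  then have d_commutes: "nprod 1 e (nprod 0 d z) = nprod 0 d (nprod 1 e z)" if "z \<in> C" for z
    using delta_act[OF d that] that by (simp add: nprod_zero_left)
  \<comment> \<open>\<open>d \<circ>\<^sub>0\<close> commutes with \<open>e \<circ>\<^sub>1\<close>, so \<open>d \<circ>\<^sub>0 d\<^sup>k\<close> is already constant and no projection is needed\<close>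
  have p_Suc: "nprod 0 d (p k) = p (Suc k)" for k
  proof -
    have "nprod 1 e (p k) = 0" using p by (simp add: constants_def)
    then have "nprod 1 e (nprod 0 d (p k)) = 0"
      unfolding d_commutes[OF pC] using dC by (simp add: nprod_zero_right)
    then have "nprod 0 d (p k) \<in> constants" using dC pC by (simp add: constants_def nprod_closed)
    then show ?thesis using rho_id by (simp add: p_def star_def)
  qed
  define m where "m k = monom (1 / fact k :: complex) k" for k
  \<comment> \<open>one summand beyond \<open>k = N\<close>, so that \<open>k = 1\<close> occurs also for \<open>N = 0\<close>\<close>
  define e' where "e' = (\<Sum>k\<le>Suc N. smul (m k) (p k))"
  have mpC: "smul (m k) (p k) \<in> C" for k by (simp add: C_smul pC)
  have e'C: "e' \<in> C" unfolding e'_def using mpC by (rule C_sum)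
  have e'_0: "nprod 0 e' z = z" if z: "z \<in> C" for z
  proof -
    have "nprod 0 e' z = (\<Sum>k\<le>Suc N. cs (coeff (m k) 0) (nprod 0 (p k) z))"
      unfolding e'_def using mpC z pC by (subst nprod_sum_left) (auto simp: nprod_0_smul_left)
    also have "\<dots> = (\<Sum>k\<le>Suc N. if k = 0 then nprod 0 (p 0) z else 0)"
      by (intro sum.cong) (auto simp: m_def)
    finally show ?thesis using z by (simp add: p_0 e_left)
  qed
  have e'_1: "nprod 1 e' z = nprod 1 e z - nprod 0 d z" if z: "z \<in> C" for z
  proof -
    have "nprod 1 e' z = (\<Sum>k\<le>Suc N. nprod 1 (smul (m k) (p k)) z)"
      unfolding e'_def using mpC z by (rule nprod_sum_left)
    also have "\<dots> = (\<Sum>k\<le>Suc N. cs (coeff (m k) 0) (nprod 1 (p k) z) - cs (coeff (m k) 1) (nprod 0 (p k) z))"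
      by (intro sum.cong refl nprod_1_smul_left pC z)
    also have "\<dots> = (\<Sum>k\<le>Suc N. (if k = 0 then nprod 1 (p 0) z else 0) - (if k = 1 then nprod 0 (p 1) z else 0))"
      by (intro sum.cong) (auto simp: m_def)
    finally show ?thesis using z by (simp add: sum_subtractf p_0 p_1[unfolded One_nat_def])
  qed
  have "nprod 1 e e' = (\<Sum>k\<le>Suc N. nprod 1 e (smul (m k) (p k)))"
    unfolding e'_def using mpC e_C by (rule nprod_sum_right)
  also have "\<dots> = (\<Sum>k\<le>Suc N. smul (monom (of_nat k / fact k) (k - 1)) (p k))"
    using p pC by (intro sum.cong refl, subst e_smul) (auto simp: m_def pderiv_monom constants_def)
  also have "\<dots> = (\<Sum>k\<le>N. smul (m k) (p (Suc k)))"
    unfolding sum.atMost_Suc_shift by (simp add: m_def del: of_nat_Suc)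
  also have "\<dots> = (\<Sum>k\<le>Suc N. smul (m k) (p (Suc k)))"
    using p_zero[of 2] by (simp add: numeral_2_eq_2)
  also have "\<dots> = nprod 0 d e'"
    unfolding e'_def using mpC dC pC by (subst nprod_sum_right) (auto simp: nprod_0_smul_right p_Suc)
  finally have e'_e': "nprod 1 e' e' = 0" using e'_1[OF e'C] by simp
  have higher: "nprod (Suc n) e' e' = 0" for n
  proof (induction n)
    case (Suc n)
    have "nprod 1 e' (nprod (Suc n) e' e') = nprod (Suc (Suc n)) e' e' + nprod (Suc n) 0 e'"
      using assoc_1[OF e'C e'C e'C, of "Suc n"] e'_e' e'C by (simp add: e'_0)
    then show ?case using Suc e'C by (simp add: nprod_zero_left nprod_zero_right)
  qed (use e'_e' in simp)
  have "nprod n e' e' = 0" if "n \<ge> 1" for n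
    using higher[of "n - 1"] that by simp
  moreover have "nprod 0 e' e' \<noteq> 0"
  proof
    assume "nprod 0 e' e' = 0"
    then have "e' = 0" using e'_0[OF e'C] by simp
    then show False using e'_0[OF e_C] e_C e_nonzero by (simp add: nprod_zero_left)
  qed
  ultimately have "conformal_identity e'"
    unfolding conformal_identity_def using e'C e'_0 by blast
  then have "finite_simple_unital_associative smul C nprod e'"
    by unfold_locales (use associative simple fin_gen in auto)
  moreover have "nprod 1 e' (nprod 0 f z) = nprod 0 f (nprod 1 e' z)" if f: "f \<in> C" and z: "z \<in> C" for f z
  proof -
    let ?a = "\<rho> f"
    have a: "?a \<in> constants" and aC: "?a \<in> C" using f by (auto simp: rho_constants rho_C)
    have cl: "star d ?a \<in> C" "star ?a d \<in> C" using aC dC by (auto simp: star_closed constants_C)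
    have "nprod 1 e' (nprod 0 ?a z) = nprod 1 e (nprod 0 ?a z) - nprod 0 d (nprod 0 ?a z)"
      using aC z by (intro e'_1 nprod_closed)
    also have "\<dots> = nprod 0 ?a (nprod 1 e z) + nprod 0 (star d ?a - star ?a d) z - nprod 0 (star d ?a) z"
      using delta_act[OF a z] inner[OF a] aC dC z by (simp add: star_act)
    also have "\<dots> = nprod 0 ?a (nprod 1 e z) - nprod 0 ?a (nprod 0 d z)"
      using cl aC dC z by (simp add: nprod_diff_left star_act)
    also have "\<dots> = nprod 0 ?a (nprod 1 e' z)"
      using aC dC z e_C e'_1[OF z] by (simp add: nprod_diff_right nprod_closed)
    finally show ?thesis using f z e'C by (simp add: nprod_0_rho nprod_closed)
  qed
  ultimately show ?thesis by blast
qed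

end

section \<open>The isomorphism with a current algebra\<close>

lemma conformal_isomorphism_inverse:
  assumes "conformal_algebra smul C nprod"
    and iso: "conformal_isomorphism smul C nprod smul' C' nprod' \<psi>"
  shows "conformal_isomorphism smul' C' nprod' smul C nprod (the_inv_into C \<psi>)"
proof -
  interpret conformal_algebra smul C nprod by fact
  have bij: "bij_betw \<psi> C C'" and add: "\<And>a b. a \<in> C \<Longrightarrow> b \<in> C \<Longrightarrow> \<psi> (a + b) = \<psi> a + \<psi> b"
    and scale: "\<And>P a. a \<in> C \<Longrightarrow> \<psi> (smul P a) = smul' P (\<psi> a)"
    and prod: "\<And>n a b. a \<in> C \<Longrightarrow> b \<in> C \<Longrightarrow> \<psi> (nprod n a b) = nprod' n (\<psi> a) (\<psi> b)"
    using iso unfolding conformal_isomorphism_def by auto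
  have inv: "the_inv_into C \<psi> (\<psi> x) = x" if "x \<in> C" for x
    using bij that by (auto simp: bij_betw_def the_inv_into_f_f)
  have img: "C' = \<psi> ` C" using bij by (simp add: bij_betw_def)
  show ?thesis
    unfolding conformal_isomorphism_def
    using bij_betw_the_inv_into[OF bij]
    by (auto simp: img inv C_intros simp flip: add scale prod)
qed

locale adapted_conformal_algebra = finite_simple_unital_associative smul C nprod e
  for smul :: "complex poly \<Rightarrow> 'c::ab_group_add \<Rightarrow> 'c" and C nprod e +
  assumes commute: "f \<in> C \<Longrightarrow> z \<in> C \<Longrightarrow> nprod 1 e (nprod 0 f z) = nprod 0 f (nprod 1 e z)"
begin

lemma constants_nprod_0:
  assumes "a \<in> constants" "b \<in> constants"
  shows "nprod 0 a b \<in> constants" "star a b = nprod 0 a b"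
proof -
  have "nprod 1 e b = 0" using assms by (simp add: constants_def)
  then have "nprod 1 e (nprod 0 a b) = 0"
    using assms commute[of a b] by (simp add: constants_C nprod_zero_right)
  then show c: "nprod 0 a b \<in> constants"
    using assms by (simp add: constants_def nprod_closed)
  then show "star a b = nprod 0 a b" by (simp add: star_def rho_id)
qed

lemma constants_nprod:
  assumes "a \<in> constants" "b \<in> constants" "n \<ge> 1"
  shows "nprod n a b = 0"
  using constants_higher[OF constants_nprod_0(1)[OF assms(1,2)] assms(3)]
    e_nprod[OF assms(1) constants_C[OF assms(2)], of n 0] by simp

text \<open>
  Matrix units of the constants give a bijection \<open>m\<close> from matrices to constants, which \<open>\<psi>\<close> extends to
  polynomials in \<open>\<partial>\<close>.  Both products obey the same laws for \<open>\<partial>\<close>, so \<open>\<psi>\<close> is multiplicative as soon as it is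
  so on constant polynomials; there both sides have \<open>\<circ>\<^sub>0\<close> multiplicative and the higher products zero.
  Injectivity and surjectivity restate \<open>C = A \<oplus> \<partial>C\<close> and the injectivity of \<open>\<partial>\<close>.
\<close>

lemma current_isomorphism:
  "\<exists>n\<ge>1. conformally_isomorphic smul C nprod
     (cur_scale mat_scale) (cur_carrier (Mat n)) (cur_prod mat_scale (mat_mult n))"
proof -
  interpret A: differential_algebra cs constants star e \<delta>
    by (rule differential_algebra_constants)
  obtain n u where u: "A.matrix_units n u" using A.matrix_units_exist by blast
  then have n: "n \<ge> 1" and uC: "\<And>i j. i < n \<Longrightarrow> j < n \<Longrightarrow> u i j \<in> constants"
    and spanning: "\<And>a. a \<in> constants \<Longrightarrow> \<exists>M. a = (\<Sum>i<n. \<Sum>j<n. cs (M i j) (u i j))"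
    unfolding A.matrix_units_def by auto
  interpret Mat: associative_algebra mat_scale "Mat n" "mat_mult n"
    by (rule associative_algebra_Mat)
  interpret cur: conformal_algebra "cur_scale mat_scale" "cur_carrier (Mat n)" "cur_prod mat_scale (mat_mult n)"
    by (rule Mat.conformal_algebra_cur)
  define m where "m M = (\<Sum>i<n. \<Sum>j<n. cs (M i j) (u i j))" for M
  have m_const: "m M \<in> constants" for M
    unfolding m_def by (intro A.A_sum A.A_scale uC) auto
  note mC = constants_C[OF m_const]
  have m_zero: "m 0 = 0" by (simp add: m_def)
  have m_add: "m (M + N) = m M + m N" for M N
    by (simp add: m_def sc.scale_left_distrib sum.distrib)
  have m_scale: "m (mat_scale c M) = cs c (m M)" for c M
    by (simp add: m_def mat_scale_def sc.scale_sum_right)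
  have m_mult: "m (mat_mult n M N) = nprod 0 (m M) (m N)" for M N
    using A.matrix_units_mult[OF u, of M N] constants_nprod_0(2)[OF m_const[of M] m_const[of N]]
    by (simp add: m_def mat_mult_def)
  have m_inj: "M = 0" if "M \<in> Mat n" "m M = 0" for M
  proof (intro ext)
    fix i j
    show "M i j = 0 i j"
      using A.matrix_units_independent[OF u, of M i j] that
      by (cases "i < n \<and> j < n") (auto simp: Mat_def m_def)
  qed
  have m_surj: "\<exists>M\<in>Mat n. a = m M" if a: "a \<in> constants" for a
  proof -
    obtain M where "a = (\<Sum>i<n. \<Sum>j<n. cs (M i j) (u i j))" using spanning[OF a] by blast
    then have "a = m (\<lambda>i j. if i < n \<and> j < n then M i j else 0)"
      by (simp add: m_def)
    then show ?thesis by (intro bexI) (auto simp: Mat_def)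
  qed
  define \<psi> where "\<psi> p = fold_coeffs (\<lambda>M x. m M + \<partial> x) p 0" for p
  have psi_0: "\<psi> 0 = 0" by (simp add: \<psi>_def)
  have psi_pCons: "\<psi> (pCons M p) = m M + \<partial> (\<psi> p)" for M p
    by (cases "p = 0 \<and> M = 0") (auto simp: \<psi>_def m_zero)
  have psi_C: "\<psi> p \<in> C" for p
    by (induction p) (auto simp: psi_0 psi_pCons C_intros mC)
  have psi_add: "\<psi> (p + q) = \<psi> p + \<psi> q" for p q
    by (induction p q rule: poly_induct2) (auto simp: psi_0 psi_pCons m_add scale_right_distrib)
  have psi_deriv: "\<psi> (cur.bd p) = \<partial> (\<psi> p)" for p
    by (simp add: Mat.cur_scale_deriv psi_pCons m_zero)
  have psi_cs: "\<psi> (cur.cs c p) = cs c (\<psi> p)" for c p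
  proof (induction p)
    case 0
    then show ?case by (simp add: psi_0)
  next
    case (pCons M p)
    have "cur.cs c (pCons M p) = pCons (mat_scale c M) (cur.cs c p)"
      by (rule poly_eqI) (simp add: Mat.coeff_cur_scale_const coeff_pCons split: nat.splits)
    then show ?case
      by (simp add: psi_pCons m_scale pCons scale_right_distrib deriv_cs)
  qed
  have psi_smul: "\<psi> (cur_scale mat_scale P p) = smul P (\<psi> p)" for P p
  proof (induction P)
    case 0
    then show ?case by (simp add: psi_0)
  next
    case (pCons c P)
    show ?case
      unfolding smul_pCons[of c P] cur.smul_pCons[of c P] psi_add psi_cs psi_deriv pCons.IH ..
  qed
  have carrier_pCons: "pCons M p \<in> cur_carrier (Mat n) \<longleftrightarrow> M \<in> Mat n \<and> p \<in> cur_carrier (Mat n)" for M p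
    by (auto simp: cur_carrier_def coeff_pCons split: nat.splits)
  have pCons_split: "pCons M p = [:M:] + cur.bd p" for M :: "nat \<Rightarrow> nat \<Rightarrow> complex" and p
    by (simp add: Mat.cur_scale_deriv)
  have zero_carrier: "(0 :: (nat \<Rightarrow> nat \<Rightarrow> complex) poly) \<in> cur_carrier (Mat n)"
    by (rule cur.C_zero)
  have prod_const: "\<psi> (cur_prod mat_scale (mat_mult n) k [:M:] q) = nprod k (m M) (\<psi> q)"
    if "M \<in> Mat n" "q \<in> cur_carrier (Mat n)" for M q k
    using that(2)
  proof (induction q arbitrary: k)
    case 0
    then show ?case
      using that zero_carrier carrier_pCons
      by (simp add: cur.nprod_zero_right psi_0 nprod_zero_right mC)
  next
    case (pCons N q)
    then have N: "N \<in> Mat n" and q: "q \<in> cur_carrier (Mat n)" by (auto simp: carrier_pCons)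
    have M': "[:M:] \<in> cur_carrier (Mat n)" and N': "[:N:] \<in> cur_carrier (Mat n)"
      using that N zero_carrier by (auto simp: carrier_pCons)
    have "cur_prod mat_scale (mat_mult n) k [:M:] (pCons N q) =
        cur_prod mat_scale (mat_mult n) k [:M:] [:N:] +
        (cur.bd (cur_prod mat_scale (mat_mult n) k [:M:] q) +
         cur.cs (of_nat k) (cur_prod mat_scale (mat_mult n) (k - 1) [:M:] q))"
      unfolding pCons_split[of N q]
      using M' N' q by (simp add: cur.nprod_add_right cur.nprod_deriv_right cur.C_smul)
    then have "\<psi> (cur_prod mat_scale (mat_mult n) k [:M:] (pCons N q)) =
        \<psi> (cur_prod mat_scale (mat_mult n) k [:M:] [:N:]) +
        (\<partial> (nprod k (m M) (\<psi> q)) + cs (of_nat k) (nprod (k - 1) (m M) (\<psi> q)))"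
      by (simp only: psi_add psi_deriv psi_cs pCons.IH[OF q])
    also have "\<psi> (cur_prod mat_scale (mat_mult n) k [:M:] [:N:]) = nprod k (m M) (m N)"
      using constants_nprod[OF m_const m_const, of k M N]
      by (simp add: Mat.cur_prod_const that N psi_0 psi_pCons m_mult)
    also have "nprod k (m M) (m N) + (\<partial> (nprod k (m M) (\<psi> q)) + cs (of_nat k) (nprod (k - 1) (m M) (\<psi> q))) =
        nprod k (m M) (\<psi> (pCons N q))"
      unfolding psi_pCons using mC psi_C
      by (simp add: nprod_add_right nprod_deriv_right C_smul)
    finally show ?case .
  qed
  have prod: "\<psi> (cur_prod mat_scale (mat_mult n) k p q) = nprod k (\<psi> p) (\<psi> q)"
    if "p \<in> cur_carrier (Mat n)" "q \<in> cur_carrier (Mat n)" for p q k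
    using that(1)
  proof (induction p arbitrary: k)
    case 0
    then show ?case using that by (simp add: cur.nprod_zero_left psi_0 nprod_zero_left psi_C)
  next
    case (pCons M p)
    then have M: "M \<in> Mat n" and p: "p \<in> cur_carrier (Mat n)" by (auto simp: carrier_pCons)
    have M': "[:M:] \<in> cur_carrier (Mat n)" using M zero_carrier by (simp add: carrier_pCons)
    have "cur_prod mat_scale (mat_mult n) k (pCons M p) q =
        cur_prod mat_scale (mat_mult n) k [:M:] q +
        cur.cs (- of_nat k) (cur_prod mat_scale (mat_mult n) (k - 1) p q)"
      unfolding pCons_split[of M p]
      using M' p that(2) by (simp only: cur.nprod_add_left cur.nprod_deriv_left cur.C_smul)
    then have "\<psi> (cur_prod mat_scale (mat_mult n) k (pCons M p) q) =
        nprod k (m M) (\<psi> q) + cs (- of_nat k) (nprod (k - 1) (\<psi> p) (\<psi> q))"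
      by (simp only: psi_add psi_cs pCons.IH[OF p] prod_const[OF M that(2)])
    also have "\<dots> = nprod k (\<psi> (pCons M p)) (\<psi> q)"
      unfolding psi_pCons using mC psi_C
      by (simp only: nprod_add_left nprod_deriv_left C_smul)
    finally show ?case .
  qed
  have kernel: "p = 0" if "p \<in> cur_carrier (Mat n)" "\<psi> p = 0" for p
    using that
  proof (induction p)
    case (pCons M p)
    then have M: "M \<in> Mat n" and p: "p \<in> cur_carrier (Mat n)" by (auto simp: carrier_pCons)
    have eq: "m M + \<partial> (\<psi> p) = 0" using pCons.prems by (simp add: psi_pCons)
    then have "m M = \<rho> 0" using rho_eq[OF m_const psi_C, of M p] by simp
    then have M0: "m M = 0" using rho_id[OF constants_zero] by simp
    then have "\<partial> (\<psi> p) \<in> constants" using eq constants_zero by simp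
    then have "\<psi> p = 0" using psi_C by (rule deriv_constant_zero[rotated])
    then show ?case using pCons.IH[OF p] m_inj[OF M M0] by simp
  qed simp
  have "inj_on \<psi> (cur_carrier (Mat n))"
  proof (rule inj_onI)
    fix p q assume pq: "p \<in> cur_carrier (Mat n)" "q \<in> cur_carrier (Mat n)" "\<psi> p = \<psi> q"
    have "\<psi> (p - q) = 0" using psi_add[of "p - q" q] pq(3) by simp
    then have "p - q = 0" using pq by (intro kernel cur.C_diff)
    then show "p = q" by simp
  qed
  moreover have "\<psi> ` cur_carrier (Mat n) = C"
  proof
    show "\<psi> ` cur_carrier (Mat n) \<subseteq> C" using psi_C by blast
    show "C \<subseteq> \<psi> ` cur_carrier (Mat n)"
    proof
      fix x assume "x \<in> C"
      then show "x \<in> \<psi> ` cur_carrier (Mat n)"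
      proof (induction x rule: C_induct)
        case (base a)
        obtain M where M: "M \<in> Mat n" "a = m M" using m_surj[OF base] by blast
        then have "a = \<psi> [:M:]" by (simp add: psi_pCons psi_0)
        then show ?case using M(1) zero_carrier by (auto simp: carrier_pCons)
      next
        case (plus x y)
        then obtain p q where "p \<in> cur_carrier (Mat n)" "q \<in> cur_carrier (Mat n)" "x = \<psi> p" "y = \<psi> q"
          by blast
        then show ?case using cur.C_add[of p q] by (simp flip: psi_add)
      next
        case (derivative x)
        then obtain p where "p \<in> cur_carrier (Mat n)" "x = \<psi> p" by blast
        then show ?case using cur.C_smul[of p "[:0, 1:]"] by (simp flip: psi_deriv)
      qed
    qed
  qed
  ultimately have "conformal_isomorphism (cur_scale mat_scale) (cur_carrier (Mat n))
      (cur_prod mat_scale (mat_mult n)) smul C nprod \<psi>"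
    unfolding conformal_isomorphism_def
    by (intro conjI ballI allI psi_add psi_smul prod) (auto simp: bij_betw_def)
  then show ?thesis
    unfolding conformally_isomorphic_def
    using conformal_isomorphism_inverse[OF cur.conformal_algebra_axioms] n by blast
qed

end

theorem theorem4p2:
  fixes smul :: "complex poly \<Rightarrow> 'c::ab_group_add \<Rightarrow> 'c"
    and C :: "'c set"
    and nprod :: "nat \<Rightarrow> 'c \<Rightarrow> 'c \<Rightarrow> 'c"
  assumes "conformal_algebra smul C nprod"
    and "conformal_algebra.associative_conformal smul C nprod"
    and "conformal_algebra.unital_conformal C nprod"
    and "conformal_algebra.simple_conformal smul C nprod"
    and "conformal_algebra.finitely_generated smul C"
  shows "\<exists>n\<ge>1. conformally_isomorphic smul C nprod
           (cur_scale mat_scale) (cur_carrier (Mat n)) (cur_prod mat_scale (mat_mult n))"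
proof -
  interpret conformal_algebra smul C nprod by fact
  obtain e where "conformal_identity e"
    using assms(3) unfolding unital_conformal_def by blast
  then interpret finite_simple_unital_associative smul C nprod e
    by unfold_locales (use assms in auto)
  obtain e' where e': "finite_simple_unital_associative smul C nprod e'"
    and commute: "\<forall>f\<in>C. \<forall>z\<in>C. nprod 1 e' (nprod 0 f z) = nprod 0 f (nprod 1 e' z)"
    using adapted_identity_exists by blast
  interpret adapted: adapted_conformal_algebra smul C nprod e'
    using e' commute by (simp add: adapted_conformal_algebra_def adapted_conformal_algebra_axioms_def)
  show ?thesis by (rule adapted.current_isomorphism)
qed

end
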